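(* Let $n\ge1$ be an integer and $\lambda$ a partition with $\ell(\lambda)\le n$ (with $\lambda_i=0$ for $i>\ell(\lambda)$, in particular $\lambda_{n+1}=0$). Then $$a_\lambda(n)=\frac{1}{\mathrm{hook}_\lambda^2\cdot o_\lambda(1^{2n})} = \begin{cases} \displaystyle\prod_{k=1}^{n-1}(2k)! \cdot \mathrm{Pf}\big(a_{\lambda_i+n-i,\lambda_j+n-j}\big)_{1 \leq i,j \leq n} & \text{for $n$ even,}\\[2mm] \displaystyle\prod_{k=1}^{n-1}(2k)! \cdot \mathrm{Pf}\big(a_{\lambda_i+n-i,\lambda_j+n-j}\big)_{1 \leq i,j \leq n+1} & \text{for $n$ odd,} \end{cases}$$ where $$a_{i,j} = \begin{cases} \frac{i-j}{4(i+j)\, i!^2\, j!^2} &\text{for } i,j\geq 1,\\ \frac{1}{2\,i!^2} &\text{for } j\in \{-1,0\},\ i > 0,\\ 1 &\text{for } j=-1,\ i=0,\\ \frac{-1}{2\,j!^2} &\text{for } i\in \{-1,0\},\ j > 0,\\ -1 &\text{for } i=-1,\ j=0,\\ 0 &\text{for } i=j\in\{-1,0\}.\end{cases}$$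
   Context: The Pfaffian of a skew-symmetric matrix $A=(a_{ij})$ of even size $m$ is $\mathrm{Pf}(A)=\frac1{2^{m/2}(m/2)!}\sum_{\sigma\in\mathfrak S_m}\mathrm{sgn}(\sigma)\prod_{i=1}^{m/2}a_{\sigma(2i-1),\sigma(2i)}$. $\mathrm{hook}_\lambda=\prod_{(x,y)\in\lambda}(\lambda_x-y+\lambda^t_y-x+1)$ is the hook product (boxes $(x,y)$: $1\le x\le\ell(\lambda)$, $1\le y\le\lambda_x$; $\lambda^t$ conjugate partition), and $o_\lambda(1^{2n})$ is the dimension of the irreducible representation of the orthogonal group $O(2n)$ of highest weight $\lambda$, given by the case $N=2n$ of $$o_\lambda(1^{N})=\frac1{\mathrm{hook}_\lambda}\prod_{(x,y)\in\lambda,\, x\le y}(N+\lambda_x+\lambda_y-x-y)\prod_{(x,y)\in\lambda,\, x>y}(N-\lambda^t_x-\lambda^t_y+x+y-2).$$ *)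

theory Defs
  imports
    Complex_Main
    "HOL-Combinatorics.Permutations"
    "Jordan_Normal_Form.Matrix"
begin

text \<open>The Pfaffian of a square matrix of even size. Rows and columns of \<open>'a mat\<close> are numbered
  from 0, so the index pair \<open>(2i - 1, 2i)\<close> of the usual formula becomes \<open>(2i, 2i + 1)\<close>.\<close>

definition pfaffian :: "'a :: field_char_0 mat \<Rightarrow> 'a" where
  "pfaffian A = (let m = dim_row A in
     (\<Sum>\<sigma> | \<sigma> permutes {0..<m}.
        of_int (sign \<sigma>) * (\<Prod>i<m div 2. A $$ (\<sigma> (2 * i), \<sigma> (2 * i + 1))))
     / (2 ^ (m div 2) * fact (m div 2)))"

text \<open>A partition is the list of its nonzero parts in weakly decreasing order, so its length
  \<open>\<ell>(\<lambda>)\<close> is the length of the list.\<close>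

definition is_partition :: "nat list \<Rightarrow> bool" where
  "is_partition lam \<longleftrightarrow> sorted_wrt (\<ge>) lam \<and> (\<forall>p\<in>set lam. p > 0)"

text \<open>Parts, rows and columns are numbered from 1. Parts beyond the length are 0; the value at
  index 0 is irrelevant.\<close>

definition part :: "nat list \<Rightarrow> nat \<Rightarrow> nat" where
  "part lam i = (if 1 \<le> i \<and> i \<le> length lam then lam ! (i - 1) else 0)"

definition conj_part :: "nat list \<Rightarrow> nat \<Rightarrow> nat" where
  "conj_part lam y = card {x \<in> {1..length lam}. y \<le> part lam x}"

definition boxes :: "nat list \<Rightarrow> (nat \<times> nat) set" where
  "boxes lam = (SIGMA x:{1..length lam}. {1..part lam x})"

definition hook_prod :: "nat list \<Rightarrow> real" where
  "hook_prod lam = (\<Prod>(x, y)\<in>boxes lam.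
     real (part lam x) - real y + real (conj_part lam y) - real x + 1)"

text \<open>\<open>o\<^sub>\<lambda>(1\<^sup>N)\<close>: for \<open>N = 2n\<close> and \<open>\<ell>(\<lambda>) \<le> n\<close>, the dimension of the irreducible representation of
  \<open>O(2n)\<close> of highest weight \<open>\<lambda>\<close>, given by the El Samra--King product formula.\<close>

definition orth_dim :: "nat list \<Rightarrow> nat \<Rightarrow> real" where
  "orth_dim lam N = 1 / hook_prod lam
     * (\<Prod>(x, y)\<in>{(x, y) \<in> boxes lam. x \<le> y}.
          real N + real (part lam x) + real (part lam y) - real x - real y)
     * (\<Prod>(x, y)\<in>{(x, y) \<in> boxes lam. x > y}.
          real N - real (conj_part lam x) - real (conj_part lam y) + real x + real y - 2)"

definition a_coeff :: "nat list \<Rightarrow> nat \<Rightarrow> real" where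
  "a_coeff lam n = 1 / ((hook_prod lam)\<^sup>2 * orth_dim lam (2 * n))"

text \<open>The numbers \<open>a\<^sub>i\<^sub>,\<^sub>j\<close> for \<open>i, j \<ge> -1\<close>. The last branch is the case \<open>i = j \<in> {-1, 0}\<close>; it also
  assigns 0 to indices below \<open>-1\<close>, which never occur.\<close>

definition pf_entry :: "int \<Rightarrow> int \<Rightarrow> real" where
  "pf_entry i j =
    (if i \<ge> 1 \<and> j \<ge> 1 then
       of_int (i - j) / (4 * of_int (i + j) * (fact (nat i))\<^sup>2 * (fact (nat j))\<^sup>2)
     else if j \<in> {-1, 0} \<and> i > 0 then 1 / (2 * (fact (nat i))\<^sup>2)
     else if j = -1 \<and> i = 0 then 1
     else if i \<in> {-1, 0} \<and> j > 0 then - 1 / (2 * (fact (nat j))\<^sup>2)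
     else if i = -1 \<and> j = 0 then - 1
     else 0)"

text \<open>The \<open>m \<times> m\<close> matrix with entries \<open>a\<close> at \<open>(\<lambda>\<^sub>i + n - i, \<lambda>\<^sub>j + n - j)\<close>, \<open>1 \<le> i, j \<le> m\<close>;
  the shift by \<open>Suc\<close> translates to the 0-based numbering of \<open>mat\<close>.\<close>

definition pf_mat :: "nat list \<Rightarrow> nat \<Rightarrow> nat \<Rightarrow> real mat" where
  "pf_mat lam n m = mat m m (\<lambda>(i, j).
     pf_entry (int (part lam (Suc i)) + int n - int (Suc i))
              (int (part lam (Suc j)) + int n - int (Suc j)))"

lemma pf_entry_skew: "pf_entry j i = - pf_entry i j"
proof (cases "i \<ge> 1 \<and> j \<ge> 1")
  case True
  have "pf_entry j i =
      of_int (j - i) / (4 * of_int (i + j) * (fact (nat i))\<^sup>2 * (fact (nat j))\<^sup>2)"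
    using True by (simp add: pf_entry_def add.commute mult_ac)
  also have "of_int (j - i) = - (of_int (i - j) :: real)"
    by simp
  finally show ?thesis
    using True by (simp only: pf_entry_def minus_divide_left simp_thms if_True)
qed (auto simp: pf_entry_def)

lemma pf_mat_skew: "transpose_mat (pf_mat lam n m) = - pf_mat lam n m"
  by (rule eq_matI) (auto simp: pf_mat_def intro: pf_entry_skew)

end

theory Submission
  imports Defs "HOL-Combinatorics.Multiset_Permutations" "HOL-Computational_Algebra.Polynomial"
begin

text \<open>Write \<open>l\<^sub>x = \<lambda>\<^sub>x + n - x\<close>. Up to the scalars \<open>1 / (2 l!\<^sup>2)\<close> pulled out of rows and columns, the matrix has
  the entries \<open>(l\<^sub>i - l\<^sub>j) / (l\<^sub>i + l\<^sub>j)\<close>, so the Pfaffian is evaluated by Schur's formula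
  \<open>\<Prod>\<^sub>i\<^sub><\<^sub>j (l\<^sub>i - l\<^sub>j) / (l\<^sub>i + l\<^sub>j)\<close>, which follows from a partial fraction identity.
  The hook product is \<open>\<Prod> l\<^sub>x! / \<Prod>\<^sub>x\<^sub><\<^sub>y (l\<^sub>x - l\<^sub>y)\<close>, because the numbers \<open>l\<^sub>y\<close> below row \<open>x\<close> and the positions
  \<open>n - 1 + y - \<lambda>\<^sup>t\<^sub>y\<close> of the columns \<open>y \<le> \<lambda>\<^sub>x\<close> partition \<open>{0..<l\<^sub>x}\<close>. The numerator of the El Samra--King formula
  is turned into that of Weyl's formula, \<open>\<Prod> l\<^sub>x! \<Prod>\<^sub>x\<^sub><\<^sub>y (l\<^sub>x + l\<^sub>y)\<close> up to powers of 2 and \<open>\<Prod> (2k)!\<close>, by adding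
  the boxes of \<open>\<lambda>\<close> one at a time.\<close>

section \<open>A partial fraction identity\<close>

text \<open>Lagrange interpolation of the monic polynomial \<open>G\<close> at the nodes
  \<open>X\<close> and 0, which are distinct because 0 is not in \<open>X\<close>. Comparing
  coefficients in degree \<open>card X\<close> gives the identity.\<close>

lemma sum_prod_sum_over_diff_nonzero:
  fixes X :: "'a::field_char_0 set"
  assumes fin: "finite X" and nz: "0 \<notin> X"
  shows "2 * (\<Sum>x\<in>X. \<Prod>y\<in>X-{x}. (x + y) / (x - y)) + (- 1) ^ card X = 1"
proof -
  define m where "m S = (\<Prod>y\<in>S. [:- y, 1:])" for S :: "'a set"
  define p where "p x = (\<Prod>y\<in>X-{x}. (x + y) / (x - y))" for x
  define G where "G = (\<Prod>y\<in>X. [:y, 1:])"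
  \<comment> \<open>The interpolant of \<open>G\<close>: \<open>2 * p x\<close> is the value of
    \<open>G\<close> at \<open>x\<close> divided by that of \<open>[:0, 1:] * m (X - {x})\<close>,
    and \<open>(- 1) ^ card X\<close> is the value of \<open>G\<close> at 0 divided by that of
    \<open>m X\<close>.\<close>
  define B where "B = (\<Sum>x\<in>X. smult (2 * p x) ([:0, 1:] * m (X - {x}))) + smult ((- 1) ^ card X) (m X)"
  have deg_m: "degree (m S) = card S" and lead_m: "coeff (m S) (card S) = 1" if "finite S" for S
  proof -
    show d: "degree (m S) = card S"
      unfolding m_def by (subst degree_prod_eq_sum_degree) auto
    have "lead_coeff (m S) = 1" unfolding m_def by (subst lead_coeff_prod) simp
    then show "coeff (m S) (card S) = 1" by (simp add: d)
  qed
  have degG: "degree G = card X" unfolding G_def by (subst degree_prod_eq_sum_degree) auto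
  have "lead_coeff G = 1" unfolding G_def by (subst lead_coeff_prod) simp
  then have leadG: "coeff G (card X) = 1" by (simp add: degG)
  have card_rem: "Suc (card (X - {x})) = card X" if "x \<in> X" for x
    using fin that by (metis card_Suc_Diff1)
  have deg_term: "degree ([:0, 1:] * m (X - {x})) \<le> card X" if "x \<in> X" for x
    by (rule order.trans[OF degree_mult_le]) (use card_rem[OF that] fin in \<open>simp add: deg_m\<close>)
  have degB: "degree B \<le> card X"
    unfolding B_def
    by (intro degree_add_le degree_sum_le fin order.trans[OF degree_smult_le] deg_term)
      (simp_all add: deg_m fin)
  have mz: "poly (m S) x = 0" if "x \<in> S" "finite S" for x S
    using that by (auto simp: m_def poly_prod)
  have eq: "poly (G - B) z = 0" if z: "z \<in> insert 0 X" for z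
  proof (cases "z = 0")
    case True
    have "poly B 0 = (- 1) ^ card X * (\<Prod>y\<in>X. - y)" by (simp add: B_def poly_sum m_def poly_prod)
    also have "(\<Prod>y\<in>X. - y) = (- 1) ^ card X * (\<Prod>y\<in>X. y)"
      by (simp add: prod_uminus)
    also have "(- 1) ^ card X * \<dots> = poly G 0"
      by (simp add: G_def poly_prod flip: mult.assoc power_mult_distrib)
    finally show ?thesis using True by simp
  next
    case False
    then have zX: "z \<in> X" using z by simp
    have "poly B z = (\<Sum>x\<in>X. 2 * p x * (z * poly (m (X - {x})) z))"
      using mz[OF zX fin] by (simp add: B_def poly_sum mult_ac)
    also have "\<dots> = 2 * p z * (z * poly (m (X - {z})) z)"
      using fin zX by (subst sum.remove[OF fin zX]) (auto intro!: sum.neutral mz)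
    also have "\<dots> = 2 * z * (p z * (\<Prod>y\<in>X-{z}. z - y))"
      by (simp add: m_def poly_prod)
    also have "p z * (\<Prod>y\<in>X-{z}. z - y) = (\<Prod>y\<in>X-{z}. z + y)"
      unfolding p_def prod.distrib[symmetric] by (intro prod.cong) auto
    also have "2 * z * \<dots> = poly G z"
      unfolding G_def poly_prod using prod.remove[OF fin zX, of "\<lambda>y. z + y"]
      by (simp add: add.commute)
    finally show ?thesis by simp
  qed
  \<comment> \<open>Both polynomials have degree at most \<open>card X\<close> and agree at
    \<open>card X + 1\<close> points.\<close>
  have "G - B = 0"
  proof (rule ccontr)
    assume *: "G - B \<noteq> 0"
    have "card (insert 0 X) \<le> card {z. poly (G - B) z = 0}"
      using eq by (intro card_mono poly_roots_finite *) auto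
    also have "\<dots> \<le> degree (G - B)" by (rule card_poly_roots_bound[OF *])
    also have "\<dots> \<le> card X" using degG degB by (intro degree_diff_le) auto
    finally show False using fin nz by simp
  qed
  then have "coeff B (card X) = 1" using leadG by simp
  moreover have "coeff B (card X) = (\<Sum>x\<in>X. 2 * p x) + (- 1) ^ card X"
  proof -
    have "coeff ([:0, 1:] * m (X - {x})) (card X) = 1" if "x \<in> X" for x
      using lead_m[of "X - {x}"] fin by (simp flip: card_rem[OF that])
    then show ?thesis by (simp add: B_def coeff_sum lead_m fin del: mult_pCons_left)
  qed
  ultimately show ?thesis by (simp add: p_def sum_distrib_left)
qed

text \<open>If 0 lies in \<open>X\<close>, it contributes a factor 1 to every other term, and its
  own term is a power of -1, so the nonzero case applied to \<open>X - {0}\<close> suffices.\<close>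

lemma sum_prod_sum_over_diff:
  fixes X :: "'a::field_char_0 set"
  assumes fin: "finite X"
  shows "(\<Sum>x\<in>X. \<Prod>y\<in>X-{x}. (x + y) / (x - y)) = (if odd (card X) then 1 else 0)"
proof (cases "0 \<in> X")
  case False
  from sum_prod_sum_over_diff_nonzero[OF fin this] show ?thesis
    by (auto simp: uminus_power_if split: if_splits)
next
  case True
  define Z where "Z = X - {0}"
  have X: "X = insert 0 Z" and Z: "0 \<notin> Z" "finite Z" using True fin by (auto simp: Z_def)
  have "(\<Prod>y\<in>X-{x}. (x + y) / (x - y)) = (\<Prod>y\<in>Z-{x}. (x + y) / (x - y))" if "x \<in> Z" for x
  proof -
    have "X - {x} = insert 0 (Z - {x})" using that Z by (auto simp: X)
    then show ?thesis using that Z by auto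
  qed
  moreover have "(\<Prod>y\<in>X-{0}. (0 + y) / (0 - y)) = (- 1) ^ card Z"
  proof -
    have "(\<Prod>y\<in>X-{0}. (0 + y) / (0 - y)) = (\<Prod>y\<in>Z. - 1)"
      using Z by (intro prod.cong) (auto simp: X)
    then show ?thesis by simp
  qed
  ultimately have "(\<Sum>x\<in>X. \<Prod>y\<in>X-{x}. (x + y) / (x - y)) =
      (- 1) ^ card Z + (\<Sum>x\<in>Z. \<Prod>y\<in>Z-{x}. (x + y) / (x - y))"
    using Z by (simp add: X)
  then show ?thesis
    using sum_prod_sum_over_diff_nonzero[OF Z(2,1)] Z
    by (auto simp: X uminus_power_if split: if_splits)
qed

section \<open>Sums over perfect matchings and alternating products\<close>

definition upper_prod :: "nat \<Rightarrow> (nat \<Rightarrow> nat \<Rightarrow> 'a::comm_monoid_mult) \<Rightarrow> 'a" where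
  "upper_prod m A = (\<Prod>i<m. \<Prod>j\<in>{i<..<m}. A i j)"

text \<open>The diagonal is exempt because \<open>schur_ratio (-1) (-1)\<close> is -1, not
  0.\<close>

definition skew_on :: "'b set \<Rightarrow> ('b \<Rightarrow> 'b \<Rightarrow> 'a::comm_ring_1) \<Rightarrow> bool" where
  "skew_on U A \<longleftrightarrow> (\<forall>i\<in>U. \<forall>j\<in>U. i \<noteq> j \<longrightarrow> A j i = - A i j)"

lemma skew_onD: "skew_on U A \<Longrightarrow> i \<in> U \<Longrightarrow> j \<in> U \<Longrightarrow> i \<noteq> j \<Longrightarrow> A j i = - A i j"
  unfolding skew_on_def by blast

lemma upper_prod_pairs: "upper_prod m A = (\<Prod>(i, j)\<in>{(i, j). i < j \<and> j < m}. A i j)"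
proof -
  have "{(i, j). i < j \<and> j < m} = (SIGMA i:{..<m}. {i<..<m})" by auto
  then show ?thesis by (simp add: upper_prod_def prod.Sigma)
qed

text \<open>An adjacent transposition permutes the pairs \<open>i < j\<close> other than
  \<open>(k, Suc k)\<close> among themselves, so only the factor of that one pair changes its
  sign.\<close>

lemma upper_prod_transpose_Suc:
  assumes skew: "skew_on {..<m} A" and k: "Suc k < m"
  shows "upper_prod m (\<lambda>i j. A (transpose k (Suc k) i) (transpose k (Suc k) j)) = - upper_prod m A"
proof -
  define \<tau> where "\<tau> = transpose k (Suc k)"
  define R where "R = {(i, j). i < j \<and> j < m} - {(k, Suc k)}"
  have fin: "finite {(i, j). i < j \<and> j < m}"
    by (rule finite_subset[of _ "{..<m} \<times> {..<m}"]) auto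
  have in_pairs: "(k, Suc k) \<in> {(i, j). i < j \<and> j < m}" using k by simp
  have invol: "\<tau> (\<tau> i) = i" for i by (simp add: \<tau>_def)
  have "(\<tau> i, \<tau> j) \<in> R" if "(i, j) \<in> R" for i j
    using that k by (auto simp: R_def \<tau>_def transpose_def)
  then have "bij_betw (map_prod \<tau> \<tau>) R R"
    by (intro bij_betwI[of _ _ _ "map_prod \<tau> \<tau>"]) (auto simp: invol)
  then have R: "(\<Prod>(i, j)\<in>R. A (\<tau> i) (\<tau> j)) = (\<Prod>(i, j)\<in>R. A i j)"
    using prod.reindex_bij_betw[of "map_prod \<tau> \<tau>" R R "\<lambda>(i, j). A i j"]
    by (simp add: case_prod_unfold map_prod_def)
  have "A (Suc k) k = - A k (Suc k)" by (rule skew_onD[OF skew]) (use k in auto)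
  moreover have "upper_prod m A = A k (Suc k) * (\<Prod>(i, j)\<in>R. A i j)"
    by (simp add: upper_prod_pairs prod.remove[OF fin in_pairs] R_def)
  moreover have "upper_prod m (\<lambda>i j. A (\<tau> i) (\<tau> j)) =
      A (\<tau> k) (\<tau> (Suc k)) * (\<Prod>(i, j)\<in>R. A (\<tau> i) (\<tau> j))"
    by (simp add: upper_prod_pairs prod.remove[OF fin in_pairs] R_def)
  ultimately show ?thesis by (simp add: R flip: \<tau>_def) (simp add: \<tau>_def)
qed

lemma upper_prod_permutes:
  assumes skew: "skew_on {..<m} A" and "\<sigma> permutes {..<m}"
  shows "upper_prod m (\<lambda>i j. A (\<sigma> i) (\<sigma> j)) = of_int (sign \<sigma>) * upper_prod m A"
proof -
  \<comment> \<open>Quantifying over all skew \<open>A\<close> makes \<open>P\<close> closed under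
    composition: the second permutation is applied to \<open>A\<close> already permuted by the
    first.\<close>
  define P where "P p \<longleftrightarrow> p permutes {..<m} \<and> (\<forall>A::nat \<Rightarrow> nat \<Rightarrow> 'a. skew_on {..<m} A \<longrightarrow>
    upper_prod m (\<lambda>i j. A (p i) (p j)) = of_int (sign p) * upper_prod m A)" for p
  have comp: "P (p \<circ> q)" if "P p" "P q" for p q
  proof -
    have pq: "p permutes {..<m}" "q permutes {..<m}" using that by (auto simp: P_def)
    have "upper_prod m (\<lambda>i j. A ((p \<circ> q) i) ((p \<circ> q) j)) = of_int (sign (p \<circ> q)) * upper_prod m A"
      if A: "skew_on {..<m} A" for A :: "nat \<Rightarrow> nat \<Rightarrow> 'a"
    proof -
      have "skew_on {..<m} (\<lambda>i j. A (p i) (p j))"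
        unfolding skew_on_def
        by (intro ballI impI skew_onD[OF A])
          (use permutes_in_image[OF pq(1)] permutes_inj[OF pq(1)] in \<open>auto simp: inj_eq\<close>)
      then have "upper_prod m (\<lambda>i j. A (p (q i)) (p (q j))) =
          of_int (sign q) * upper_prod m (\<lambda>i j. A (p i) (p j))"
        using \<open>P q\<close> unfolding P_def by blast
      also have "upper_prod m (\<lambda>i j. A (p i) (p j)) = of_int (sign p) * upper_prod m A"
        using \<open>P p\<close> A unfolding P_def by blast
      finally show ?thesis
        using pq by (simp add: sign_compose permutes_imp_permutation[OF finite_lessThan])
    qed
    then show ?thesis using pq by (simp add: P_def permutes_compose)
  qed
  have adj: "P (transpose k (Suc k))" if "Suc k < m" for k
    using that by (simp add: P_def upper_prod_transpose_Suc permutes_swap_id sign_swap_id)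
  have transp: "P (transpose a b)" if "a < b" "b < m" for a b
    using that
  proof (induction b)
    case (Suc b)
    show ?case
    proof (cases "a = b")
      case False
      \<comment> \<open>An arbitrary transposition arises from adjacent ones by conjugation.\<close>
      have "P (transpose b (Suc b) \<circ> transpose a b \<circ> transpose b (Suc b))"
        using Suc False by (intro comp adj) auto
      also have "transpose b (Suc b) \<circ> transpose a b \<circ> transpose b (Suc b) = transpose a (Suc b)"
        using Suc.prems False by (auto simp: transpose_def fun_eq_iff)
      finally show ?thesis .
    qed (use adj Suc in auto)
  qed auto
  have "P id" by (simp add: P_def permutes_id sign_id)
  from assms(2) finite_lessThan have "P \<sigma>"
  proof (induction rule: permutes_induct)
    case (swap a b p)
    then show ?case
      by (metis comp transp lessThan_iff linorder_neqE_nat transpose_commute)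
  qed (fact \<open>P id\<close>)
  then show ?thesis using skew by (simp add: P_def)
qed

text \<open>The monomial of the Pfaffian belonging to a permutation, read off the list of its
  values; lists allow the first pair to be split off.\<close>

definition pair_prod :: "('b \<Rightarrow> 'b \<Rightarrow> 'a::comm_monoid_mult) \<Rightarrow> 'b list \<Rightarrow> 'a" where
  "pair_prod A xs = (\<Prod>i<length xs div 2. A (xs ! (2 * i)) (xs ! (2 * i + 1)))"

lemma pair_prod_Cons_Cons: "pair_prod A (a # b # xs) = A a b * pair_prod A xs"
  unfolding pair_prod_def by (simp add: prod.lessThan_Suc_shift del: prod.lessThan_Suc)

definition list_upper_prod :: "('b \<Rightarrow> 'b \<Rightarrow> 'a::comm_monoid_mult) \<Rightarrow> 'b list \<Rightarrow> 'a" where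
  "list_upper_prod A xs = upper_prod (length xs) (\<lambda>i j. A (xs ! i) (xs ! j))"

lemma list_upper_prod_Cons:
  assumes "distinct xs"
  shows "list_upper_prod A (a # xs) = (\<Prod>c\<in>set xs. A a c) * list_upper_prod A xs"
proof -
  have im: "{Suc i<..<Suc n} = Suc ` {i<..<n}" "{0<..<Suc n} = Suc ` {..<n}" for i n
    by (auto simp: image_iff gr0_conv_Suc Suc_less_eq2)
  have "(\<Prod>j<length xs. A a (xs ! j)) = (\<Prod>c\<in>set xs. A a c)"
    by (rule prod.reindex_bij_betw[OF bij_betw_nth[OF assms refl refl]])
  then show ?thesis
    by (simp add: list_upper_prod_def upper_prod_def prod.lessThan_Suc_shift im prod.reindex
        del: prod.lessThan_Suc)
qed

lemma sum_permutations_of_set: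
  assumes "finite X" "X \<noteq> {}"
  shows "(\<Sum>xs\<in>permutations_of_set X. f xs) =
    (\<Sum>a\<in>X. \<Sum>xs\<in>permutations_of_set (X - {a}). f (a # xs))"
proof -
  have "(\<Sum>xs\<in>permutations_of_set X. f xs) =
      (\<Sum>a\<in>X. \<Sum>xs\<in>(#) a ` permutations_of_set (X - {a}). f xs)"
    unfolding permutations_of_set_nonempty[OF assms(2)]
    using assms by (intro sum.UNION_disjoint) auto
  then show ?thesis by (simp add: sum.reindex)
qed

text \<open>As \<open>upper_prod\<close> is alternating, dividing by it absorbs the signs in the Pfaffian. The remaining
  sign-free sum is evaluated by splitting off the first pair \<open>a, b\<close>.\<close>

lemma sum_pair_prod_over_upper_prod:
  fixes S :: "'b \<Rightarrow> 'b \<Rightarrow> 'a::field_char_0"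
  assumes nz: "\<And>a b. a \<in> U \<Longrightarrow> b \<in> U \<Longrightarrow> a \<noteq> b \<Longrightarrow> S a b \<noteq> 0"
    and rel: "\<And>X a. finite X \<Longrightarrow> X \<subseteq> U \<Longrightarrow> even (card X) \<Longrightarrow> a \<in> X \<Longrightarrow>
      (\<Sum>b\<in>X-{a}. \<Prod>c\<in>X-{a}-{b}. 1 / (S a c * S b c)) = 1"
    and X: "finite X" "X \<subseteq> U" "card X = 2 * k"
  shows "(\<Sum>xs\<in>permutations_of_set X. pair_prod S xs / list_upper_prod S xs) = 2 ^ k * fact k"
  using X
proof (induction k arbitrary: X)
  case 0
  then show ?case by (simp add: pair_prod_def list_upper_prod_def upper_prod_def)
next
  case (Suc k)
  have ne: "X \<noteq> {}" using Suc.prems by auto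
  have "(\<Sum>xs\<in>permutations_of_set X. pair_prod S xs / list_upper_prod S xs) =
     (\<Sum>a\<in>X. \<Sum>b\<in>X-{a}. \<Sum>xs\<in>permutations_of_set (X-{a}-{b}).
        pair_prod S (a # b # xs) / list_upper_prod S (a # b # xs))"
  proof (subst sum_permutations_of_set[OF Suc.prems(1) ne], rule sum.cong[OF refl],
         rule sum_permutations_of_set)
    fix a assume "a \<in> X"
    then have "card (X - {a}) = Suc (2 * k)" using Suc.prems by simp
    then show "X - {a} \<noteq> {}" by (metis card.empty nat.distinct(1))
  qed (use Suc.prems in auto)
  \<comment> \<open>The factor \<open>S a b\<close> cancels. What is left of \<open>a\<close> and
    \<open>b\<close> does not depend on the order of the remaining elements, so the induction
    hypothesis evaluates the inner sum.\<close>
  also have "\<dots> = (\<Sum>a\<in>X. \<Sum>b\<in>X-{a}.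
      (\<Prod>c\<in>X-{a}-{b}. 1 / (S a c * S b c)) * (2 ^ k * fact k))"
  proof (intro sum.cong refl)
    fix a b assume ab: "a \<in> X" "b \<in> X - {a}"
    define Y where "Y = X - {a} - {b}"
    have Y: "finite Y" "Y \<subseteq> U" "card Y = 2 * k" using Suc.prems ab by (auto simp: Y_def)
    have Sab: "S a b \<noteq> 0" using nz ab Suc.prems by auto
    have "pair_prod S (a # b # xs) / list_upper_prod S (a # b # xs) =
        (\<Prod>c\<in>Y. 1 / (S a c * S b c)) * (pair_prod S xs / list_upper_prod S xs)"
      if "xs \<in> permutations_of_set Y" for xs
    proof -
      have xs: "set xs = Y" "distinct xs" using permutations_of_setD[OF that] by auto
      have "b \<notin> Y" by (simp add: Y_def)
      then have "list_upper_prod S (a # b # xs) =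
          S a b * (\<Prod>c\<in>Y. S a c) * ((\<Prod>c\<in>Y. S b c) * list_upper_prod S xs)"
        using xs Y by (simp add: list_upper_prod_Cons)
      then show ?thesis
        using Sab by (simp add: pair_prod_Cons_Cons prod.distrib prod_dividef)
    qed
    then show "(\<Sum>xs\<in>permutations_of_set (X-{a}-{b}).
        pair_prod S (a # b # xs) / list_upper_prod S (a # b # xs)) =
        (\<Prod>c\<in>X-{a}-{b}. 1 / (S a c * S b c)) * (2 ^ k * fact k)"
      using Suc.IH[OF Y] by (simp add: Y_def flip: sum_distrib_left times_divide_eq_right)
  qed
  \<comment> \<open>For each first element \<open>a\<close>, the sum over \<open>b\<close> is 1 by
    \<open>rel\<close>.\<close>
  also have "\<dots> = of_nat (card X) * (2 ^ k * fact k)"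
    using Suc.prems rel[OF Suc.prems(1,2)] by (simp flip: sum_distrib_right)
  also have "\<dots> = 2 ^ Suc k * fact (Suc k)"
    by (simp only: Suc.prems) (simp add: algebra_simps)
  finally show ?case .
qed

lemma bij_betw_permutes_permutations_of_set:
  "bij_betw (\<lambda>\<sigma>. map \<sigma> [0..<m]) {\<sigma>. \<sigma> permutes {..<m}} (permutations_of_set {..<m})"
proof -
  have inj: "inj_on (\<lambda>\<sigma>. map \<sigma> [0..<m]) {\<sigma>. \<sigma> permutes {..<m}}"
    by (rule inj_onI) (auto simp: fun_eq_iff permutes_def)
  have sub: "(\<lambda>\<sigma>. map \<sigma> [0..<m]) ` {\<sigma>. \<sigma> permutes {..<m}} \<subseteq> permutations_of_set {..<m}"
    by (auto simp: permutations_of_set_def distinct_map permutes_inj_on permutes_in_image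
        permutes_image lessThan_atLeast0[symmetric])
  have "card ((\<lambda>\<sigma>. map \<sigma> [0..<m]) ` {\<sigma>. \<sigma> permutes {..<m}}) = card (permutations_of_set {..<m})"
    by (subst card_image[OF inj]) (simp add: card_permutations[OF refl])
  then show ?thesis
    unfolding bij_betw_def using inj sub by (simp add: card_subset_eq)
qed

lemma pfaffian_sum_eq_upper_prod:
  fixes S :: "nat \<Rightarrow> nat \<Rightarrow> 'a::field_char_0"
  assumes skew: "skew_on {..<2 * k} S"
    and nz: "\<And>a b. a < 2 * k \<Longrightarrow> b < 2 * k \<Longrightarrow> a \<noteq> b \<Longrightarrow> S a b \<noteq> 0"
    and rel: "\<And>X a. finite X \<Longrightarrow> X \<subseteq> {..<2 * k} \<Longrightarrow> even (card X) \<Longrightarrow> a \<in> X \<Longrightarrow>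
      (\<Sum>b\<in>X-{a}. \<Prod>c\<in>X-{a}-{b}. 1 / (S a c * S b c)) = 1"
  shows "(\<Sum>\<sigma> | \<sigma> permutes {..<2 * k}. of_int (sign \<sigma>) * (\<Prod>i<k. S (\<sigma> (2 * i)) (\<sigma> (2 * i + 1))))
    = 2 ^ k * fact k * upper_prod (2 * k) S"
proof -
  let ?m = "2 * k"
  have "upper_prod ?m S \<noteq> 0" using nz by (auto simp: upper_prod_def)
  have sq: "of_int (sign \<sigma>) * of_int (sign \<sigma>) = (1::'a)" for \<sigma> :: "nat \<Rightarrow> nat"
    by (simp add: sign_def)
  \<comment> \<open>Permuting multiplies \<open>upper_prod\<close> by the sign, which is its own
    inverse, so the quotient carries exactly the sign of the summand.\<close>
  have "of_int (sign \<sigma>) * (\<Prod>i<k. S (\<sigma> (2 * i)) (\<sigma> (2 * i + 1))) =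
     upper_prod ?m S * (pair_prod S (map \<sigma> [0..<?m]) / list_upper_prod S (map \<sigma> [0..<?m]))"
    if \<sigma>: "\<sigma> permutes {..<?m}" for \<sigma>
  proof -
    have "list_upper_prod S (map \<sigma> [0..<?m]) = upper_prod ?m (\<lambda>i j. S (\<sigma> i) (\<sigma> j))"
      unfolding list_upper_prod_def upper_prod_def by (auto intro!: prod.cong)
    also have "\<dots> = of_int (sign \<sigma>) * upper_prod ?m S" by (rule upper_prod_permutes[OF skew \<sigma>])
    finally have V: "list_upper_prod S (map \<sigma> [0..<?m]) = of_int (sign \<sigma>) * upper_prod ?m S" .
    have w: "pair_prod S (map \<sigma> [0..<?m]) = (\<Prod>i<k. S (\<sigma> (2 * i)) (\<sigma> (2 * i + 1)))"
      unfolding pair_prod_def by (auto intro!: prod.cong)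
    show ?thesis
      using \<open>upper_prod ?m S \<noteq> 0\<close> sq[of \<sigma>] unfolding V w by (simp add: sign_def)
  qed
  then have "(\<Sum>\<sigma> | \<sigma> permutes {..<?m}. of_int (sign \<sigma>) * (\<Prod>i<k. S (\<sigma> (2 * i)) (\<sigma> (2 * i + 1))))
     = upper_prod ?m S * (\<Sum>\<sigma> | \<sigma> permutes {..<?m}.
         pair_prod S (map \<sigma> [0..<?m]) / list_upper_prod S (map \<sigma> [0..<?m]))"
    by (simp add: sum_distrib_left)
  also have "(\<Sum>\<sigma> | \<sigma> permutes {..<?m}.
         pair_prod S (map \<sigma> [0..<?m]) / list_upper_prod S (map \<sigma> [0..<?m])) =
      (\<Sum>xs\<in>permutations_of_set {..<?m}. pair_prod S xs / list_upper_prod S xs)"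
    by (rule sum.reindex_bij_betw[OF bij_betw_permutes_permutations_of_set])
  also have "\<dots> = 2 ^ k * fact k"
    by (rule sum_pair_prod_over_upper_prod[where U = "{..<?m}"]) (use nz rel in auto)
  finally show ?thesis by (simp add: mult.commute)
qed

section \<open>Schur's Pfaffian\<close>

text \<open>The index \<open>-1\<close> behaves like a nonnegative quantity infinitely smaller than all the others, 0 included.\<close>

definition schur_ratio :: "int \<Rightarrow> int \<Rightarrow> real" where
  "schur_ratio i j = (if i = -1 then -1 else if j = -1 then 1 else of_int (i - j) / of_int (i + j))"

definition entry_scale :: "int \<Rightarrow> real" where
  "entry_scale i = (if i > 0 then 1 / (2 * (fact (nat i))\<^sup>2) else 1)"

text \<open>The ratio is 1 if the first index is positive and the second is 0 or -1, which accounts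
  for the special entries. The diagonal is excluded since at \<open>(-1, -1)\<close> the entry is 0
  but the ratio is -1.\<close>

lemma pf_entry_eq:
  assumes "i \<ge> -1" "j \<ge> -1" "i \<noteq> j"
  shows "pf_entry i j = entry_scale i * entry_scale j * schur_ratio i j"
proof -
  consider "i \<ge> 1" "j \<ge> 1" | "i \<ge> 1" "j = 0" | "i \<ge> 1" "j = -1" | "i = 0" "j \<ge> 1" | "i = -1" "j \<ge> 1"
    | "i = 0" "j = -1" | "i = -1" "j = 0"
    using assms by force
  then show ?thesis
    by cases (auto simp: pf_entry_def entry_scale_def schur_ratio_def)
qed

lemma schur_ratio_nonneg:
  "i \<ge> 0 \<Longrightarrow> j \<ge> 0 \<Longrightarrow> schur_ratio i j = (real_of_int i - real_of_int j) / (real_of_int i + real_of_int j)"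
  by (simp add: schur_ratio_def)

lemma schur_ratio_skew: "i \<ge> -1 \<Longrightarrow> j \<ge> -1 \<Longrightarrow> i \<noteq> j \<Longrightarrow> schur_ratio j i = - schur_ratio i j"
  by (simp add: schur_ratio_def add.commute minus_divide_left)

lemma schur_ratio_nonzero: "i \<ge> -1 \<Longrightarrow> j \<ge> -1 \<Longrightarrow> i \<noteq> j \<Longrightarrow> schur_ratio i j \<noteq> 0"
  by (auto simp: schur_ratio_def simp flip: of_int_add)

lemma sum_prod_schur_ratio:
  assumes "finite Y" "Y \<subseteq> {0..}"
  shows "(\<Sum>b\<in>Y. \<Prod>c\<in>Y-{b}. 1 / schur_ratio b c) = (if odd (card Y) then 1 else 0)"
proof -
  let ?X = "real_of_int ` Y"
  have inj: "inj_on real_of_int Y" by (simp add: inj_on_def)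
  have "(\<Sum>b\<in>Y. \<Prod>c\<in>Y-{b}. 1 / schur_ratio b c) =
      (\<Sum>b\<in>Y. \<Prod>c\<in>Y-{b}. (real_of_int b + real_of_int c) / (real_of_int b - real_of_int c))"
    using assms by (intro sum.cong prod.cong refl) (auto simp: schur_ratio_nonneg subset_iff)
  also have "\<dots> = (\<Sum>x\<in>?X. \<Prod>y\<in>?X-{x}. (x + y) / (x - y))"
  unfolding sum.reindex[OF inj]
  proof (rule sum.cong[OF refl])
    fix b assume "b \<in> Y"
    have "?X - {real_of_int b} = real_of_int ` (Y - {b})" by auto
    then show "(\<Prod>c\<in>Y-{b}. (real_of_int b + real_of_int c) / (real_of_int b - real_of_int c)) =
      ((\<lambda>x. \<Prod>y\<in>?X-{x}. (x + y) / (x - y)) \<circ> real_of_int) b"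
      by (simp add: prod.reindex inj_on_def)
  qed
  also have "\<dots> = (if odd (card Y) then 1 else 0)"
    using assms by (subst sum_prod_sum_over_diff) (auto simp: card_image[OF inj])
  finally show ?thesis .
qed

text \<open>Applying \<open>sum_prod_sum_over_diff\<close> to \<open>Y \<union> {- a}\<close> expands \<open>\<Prod>c\<in>Y. schur_ratio a c\<close> in partial fractions.\<close>

lemma sum_prod_schur_ratio_row:
  assumes Y: "finite Y" "Y \<subseteq> {0..}" and a: "a \<ge> 0" "a \<notin> Y"
  shows "(\<Sum>b\<in>Y. \<Prod>c\<in>Y-{b}. 1 / (schur_ratio a c * schur_ratio b c)) =
    1 - (if even (card Y) then \<Prod>c\<in>Y. 1 / schur_ratio a c else 0)"
proof -
  let ?r = real_of_int
  let ?X = "?r ` Y"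
  have inj: "inj_on ?r Y" by (simp add: inj_on_def)
  define p where "p b = (\<Prod>c\<in>Y-{b}. 1 / schur_ratio b c)" for b
  define F where "F = (\<Prod>c\<in>Y. schur_ratio a c)"
  have nzs: "schur_ratio a c \<noteq> 0" if "c \<in> Y" for c
    using that Y a by (intro schur_ratio_nonzero) (auto simp: subset_iff intro: order_trans[of _ 0])
  then have F: "F \<noteq> 0" using Y by (simp add: F_def)
  \<comment> \<open>For \<open>a = 0\<close> this is \<open>a \<notin> Y\<close>; otherwise
    \<open>- a\<close> is negative while \<open>Y\<close> is not.\<close>
  have ma: "- ?r a \<notin> ?X"
  proof
    assume "- ?r a \<in> ?X"
    then obtain c where "c \<in> Y" "c = - a" by (metis imageE of_int_eq_iff of_int_minus)
    then show False using Y a by (cases "a = 0") auto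
  qed
  \<comment> \<open>The term of the node \<open>- a\<close> is \<open>F\<close>; in the term of any
    other node \<open>b\<close>, the node \<open>- a\<close> adds the factor
    \<open>- schur_ratio a b\<close>.\<close>
  have "(\<Sum>x\<in>insert (- ?r a) ?X. \<Prod>y\<in>insert (- ?r a) ?X-{x}. (x + y) / (x - y)) =
      (if even (card Y) then 1 else 0)"
    using Y ma by (subst sum_prod_sum_over_diff) (auto simp: card_image[OF inj])
  also have "(\<Sum>x\<in>insert (- ?r a) ?X. \<Prod>y\<in>insert (- ?r a) ?X-{x}. (x + y) / (x - y)) =
      (\<Prod>y\<in>?X. (- ?r a + y) / (- ?r a - y)) +
      (\<Sum>x\<in>?X. \<Prod>y\<in>insert (- ?r a) ?X-{x}. (x + y) / (x - y))"
    using Y ma by simp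
  also have "(\<Prod>y\<in>?X. (- ?r a + y) / (- ?r a - y)) = F"
    unfolding F_def prod.reindex[OF inj]
  proof (rule prod.cong[OF refl])
    fix c assume "c \<in> Y"
    then have "schur_ratio a c = (?r a - ?r c) / (?r a + ?r c)"
      using Y a by (auto simp: schur_ratio_nonneg)
    also have "\<dots> = - (?r a - ?r c) / - (?r a + ?r c)" by (rule minus_divide_divide[symmetric])
    finally show "((\<lambda>y. (- ?r a + y) / (- ?r a - y)) \<circ> ?r) c = schur_ratio a c" by simp
  qed
  also have "(\<Sum>x\<in>?X. \<Prod>y\<in>insert (- ?r a) ?X-{x}. (x + y) / (x - y)) = (\<Sum>b\<in>Y. - (schur_ratio a b * p b))"
  unfolding sum.reindex[OF inj]
  proof (rule sum.cong[OF refl])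
    fix b assume b: "b \<in> Y"
    have "insert (- ?r a) ?X - {?r b} = insert (- ?r a) (?r ` (Y - {b}))" using b ma by auto
    moreover have "- ?r a \<notin> ?r ` (Y - {b})" using ma by auto
    moreover have "(\<Prod>c\<in>Y-{b}. (?r b + ?r c) / (?r b - ?r c)) = p b"
      unfolding p_def using Y b by (intro prod.cong refl) (auto simp: schur_ratio_nonneg subset_iff)
    moreover have "(?r b + - ?r a) / (?r b - - ?r a) = - schur_ratio a b"
      using Y a b by (auto simp: schur_ratio_nonneg subset_iff add.commute minus_divide_left)
    ultimately show "((\<lambda>x. \<Prod>y\<in>insert (- ?r a) ?X-{x}. (x + y) / (x - y)) \<circ> ?r) b =
        - (schur_ratio a b * p b)"
      using Y by (simp add: prod.reindex inj_on_def)
  qed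
  finally have main: "(\<Sum>b\<in>Y. schur_ratio a b * p b) = F - (if even (card Y) then 1 else 0)"
    by (simp add: sum_negf)
  \<comment> \<open>Dividing by \<open>F\<close> turns \<open>schur_ratio a b\<close> into the
    reciprocals of all the other \<open>schur_ratio a c\<close>.\<close>
  have "(\<Sum>b\<in>Y. \<Prod>c\<in>Y-{b}. 1 / (schur_ratio a c * schur_ratio b c)) =
      (\<Sum>b\<in>Y. schur_ratio a b * p b) / F"
    unfolding sum_divide_distrib
  proof (rule sum.cong[OF refl])
    fix b assume b: "b \<in> Y"
    have "F = schur_ratio a b * (\<Prod>c\<in>Y-{b}. schur_ratio a c)"
      unfolding F_def using b Y by (simp add: prod.remove)
    then show "(\<Prod>c\<in>Y-{b}. 1 / (schur_ratio a c * schur_ratio b c)) = schur_ratio a b * p b / F"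
      using nzs[OF b] by (simp add: p_def prod_dividef prod.distrib)
  qed
  also have "\<dots> = 1 - (if even (card Y) then 1 / F else 0)"
    unfolding main using F by (simp add: diff_divide_distrib)
  finally show ?thesis by (simp add: F_def prod_dividef)
qed

text \<open>If \<open>a = -1\<close>, an even number of factors -1 drops out. If -1 is not in
  \<open>X\<close>, the row identity has no correction term, as the remaining cardinality is odd. If
  -1 is another element, its term is exactly the correction term of the row identity for the
  others.\<close>

lemma schur_ratio_relation:
  assumes X: "finite X" "X \<subseteq> {-1..}" "even (card X)" and a: "a \<in> X"
  shows "(\<Sum>b\<in>X-{a}. \<Prod>c\<in>X-{a}-{b}. 1 / (schur_ratio a c * schur_ratio b c)) = 1"
proof -
  have odd: "odd (card (X - {a}))" using X a by (metis card_Suc_Diff1 even_Suc)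
  consider "a = -1" | "a \<noteq> -1" "-1 \<notin> X" | "a \<noteq> -1" "-1 \<in> X" by blast
  then show ?thesis
  proof cases
    case 1
    define Y where "Y = X - {a}"
    have Y: "finite Y" "Y \<subseteq> {0..}" using X 1 by (force simp: Y_def)+
    have "(\<Sum>b\<in>Y. \<Prod>c\<in>Y-{b}. 1 / (schur_ratio a c * schur_ratio b c)) =
        (\<Sum>b\<in>Y. \<Prod>c\<in>Y-{b}. 1 / schur_ratio b c)"
    proof (rule sum.cong[OF refl])
      fix b assume "b \<in> Y"
      then have "even (card (Y - {b}))" using odd Y by (simp add: Y_def)
      then show "(\<Prod>c\<in>Y-{b}. 1 / (schur_ratio a c * schur_ratio b c)) =
          (\<Prod>c\<in>Y-{b}. 1 / schur_ratio b c)"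
        by (simp add: 1 schur_ratio_def[of "-1"] prod_dividef prod_uminus)
    qed
    then show ?thesis using sum_prod_schur_ratio[OF Y] odd by (simp add: Y_def)
  next
    case 2
    have "X - {a} \<subseteq> {0..}"
    proof
      fix x assume x: "x \<in> X - {a}"
      then have "x \<noteq> -1" "x \<ge> -1" using X 2 by auto
      then show "x \<in> {0..}" by simp
    qed
    moreover have "a \<ge> -1" using X a by auto
    ultimately show ?thesis
      using sum_prod_schur_ratio_row[of "X - {a}" a] X 2 odd by auto
  next
    case 3
    define Y where "Y = X - {a} - {-1}"
    have XY: "X - {a} = insert (-1) Y" "-1 \<notin> Y" using 3 by (auto simp: Y_def)
    have Y: "finite Y" "Y \<subseteq> {0..}" "a \<notin> Y" using X by (force simp: Y_def)+
    have evenY: "even (card Y)" using odd XY Y by simp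
    have "a \<ge> -1" using X a by auto
    then have a0: "a \<ge> 0" using 3 by simp
    have "(\<Sum>b\<in>X-{a}. \<Prod>c\<in>X-{a}-{b}. 1 / (schur_ratio a c * schur_ratio b c)) =
      (\<Prod>c\<in>Y. 1 / (schur_ratio a c * schur_ratio (-1) c)) +
      (\<Sum>b\<in>Y. \<Prod>c\<in>insert (-1) Y - {b}. 1 / (schur_ratio a c * schur_ratio b c))"
      using XY Y by simp
    also have "(\<Prod>c\<in>Y. 1 / (schur_ratio a c * schur_ratio (-1) c)) = (\<Prod>c\<in>Y. 1 / schur_ratio a c)"
      using evenY by (simp add: schur_ratio_def[of "-1"] prod_dividef prod_uminus)
    also have "(\<Sum>b\<in>Y. \<Prod>c\<in>insert (-1) Y - {b}. 1 / (schur_ratio a c * schur_ratio b c)) =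
      (\<Sum>b\<in>Y. \<Prod>c\<in>Y-{b}. 1 / (schur_ratio a c * schur_ratio b c))"
    proof (rule sum.cong[OF refl])
      fix b assume "b \<in> Y"
      then have b: "b \<noteq> -1" "b \<ge> 0" "insert (-1) Y - {b} = insert (-1) (Y - {b})" using Y XY by auto
      show "(\<Prod>c\<in>insert (-1) Y - {b}. 1 / (schur_ratio a c * schur_ratio b c)) =
        (\<Prod>c\<in>Y-{b}. 1 / (schur_ratio a c * schur_ratio b c))"
        using Y XY b a0 by (simp add: schur_ratio_def[of _ "-1"])
    qed
    finally show ?thesis using sum_prod_schur_ratio_row[OF Y(1,2) a0 Y(3)] evenY by simp
  qed
qed

text \<open>Each monomial uses every index once and no diagonal entry, so all scales come out as one
  common factor and Schur's Pfaffian remains.\<close>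

lemma pfaffian_pf_entry:
  fixes v :: "nat \<Rightarrow> int"
  assumes inj: "inj_on v {..<2 * k}" and v: "\<And>i. i < 2 * k \<Longrightarrow> v i \<ge> -1"
  shows "pfaffian (mat (2 * k) (2 * k) (\<lambda>(i, j). pf_entry (v i) (v j))) =
    (\<Prod>i<2 * k. entry_scale (v i)) * upper_prod (2 * k) (\<lambda>i j. schur_ratio (v i) (v j))"
proof -
  let ?m = "2 * k"
  define S where "S i j = schur_ratio (v i) (v j)" for i j
  define D where "D = (\<Prod>i<?m. entry_scale (v i))"
  have ne: "v i \<noteq> v j" if "i < ?m" "j < ?m" "i \<noteq> j" for i j
    using inj that by (auto simp: inj_on_def)
  \<comment> \<open>The relation among values carries over to indices along the injective
    \<open>v\<close>.\<close>
  have rel: "(\<Sum>b\<in>X-{a}. \<Prod>c\<in>X-{a}-{b}. 1 / (S a c * S b c)) = 1"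
    if X: "finite X" "X \<subseteq> {..<?m}" "even (card X)" and a: "a \<in> X" for X a
  proof -
    have injX: "inj_on v X" using inj X by (blast intro: inj_on_subset)
    have im: "v ` X - {v a} = v ` (X - {a})" "inj_on v (X - {a})"
      using injX a by (auto simp: inj_on_def)
    have im2: "v ` (X - {a}) - {v b} = v ` (X - {a} - {b})" "inj_on v (X - {a} - {b})"
      if "b \<in> X - {a}" for b
      using injX a that by (auto simp: inj_on_def)
    have "(\<Sum>b\<in>v ` X-{v a}. \<Prod>c\<in>v ` X-{v a}-{b}. 1 / (schur_ratio (v a) c * schur_ratio b c)) = 1"
      by (rule schur_ratio_relation) (use X a v injX in \<open>auto simp: card_image\<close>)
    moreover have "(\<Prod>c\<in>v ` (X-{a})-{v b}. 1 / (schur_ratio (v a) c * schur_ratio (v b) c)) =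
        (\<Prod>c\<in>X-{a}-{b}. 1 / (S a c * S b c))" if "b \<in> X - {a}" for b
      unfolding im2(1)[OF that] prod.reindex[OF im2(2)[OF that]] by (simp add: S_def)
    ultimately show ?thesis
      unfolding im(1) sum.reindex[OF im(2)] by simp
  qed
  have "(\<Prod>i<k. pf_entry (v (\<sigma> (2 * i))) (v (\<sigma> (2 * i + 1)))) =
      D * (\<Prod>i<k. S (\<sigma> (2 * i)) (\<sigma> (2 * i + 1)))" if \<sigma>: "\<sigma> permutes {..<?m}" for \<sigma>
  proof -
    have \<sigma>_lt: "\<sigma> i < ?m" if "i < ?m" for i using permutes_in_image[OF \<sigma>] that by auto
    have "pf_entry (v (\<sigma> (2 * i))) (v (\<sigma> (2 * i + 1))) = 
       entry_scale (v (\<sigma> (2 * i))) * entry_scale (v (\<sigma> (2 * i + 1))) * S (\<sigma> (2 * i)) (\<sigma> (2 * i + 1))"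
      if "i < k" for i
      unfolding S_def
      by (intro pf_entry_eq v \<sigma>_lt ne) (use that permutes_inj[OF \<sigma>] in \<open>auto simp: inj_eq\<close>)
    then have "(\<Prod>i<k. pf_entry (v (\<sigma> (2 * i))) (v (\<sigma> (2 * i + 1)))) =
      (\<Prod>i<k. entry_scale (v (\<sigma> (2 * i))) * entry_scale (v (\<sigma> (2 * i + 1)))) *
      (\<Prod>i<k. S (\<sigma> (2 * i)) (\<sigma> (2 * i + 1)))"
      by (simp add: prod.distrib)
    also have "(\<Prod>i<k. entry_scale (v (\<sigma> (2 * i))) * entry_scale (v (\<sigma> (2 * i + 1)))) =
        (\<Prod>i<?m. entry_scale (v (\<sigma> i)))"
      by (induction k) (simp_all add: mult_ac)
    also have "\<dots> = D"
      unfolding D_def using prod.permute[OF \<sigma>, of "\<lambda>i. entry_scale (v i)"] by (simp add: o_def)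
    finally show ?thesis .
  qed
  note entries = this
  have "(\<Sum>\<sigma> | \<sigma> permutes {0..<?m}. of_int (sign \<sigma>) *
      (\<Prod>i<?m div 2. mat ?m ?m (\<lambda>(i, j). pf_entry (v i) (v j)) $$ (\<sigma> (2 * i), \<sigma> (2 * i + 1)))) =
      (\<Sum>\<sigma> | \<sigma> permutes {..<?m}. D * (of_int (sign \<sigma>) * (\<Prod>i<k. S (\<sigma> (2 * i)) (\<sigma> (2 * i + 1)))))"
  proof (rule sum.cong)
    fix \<sigma> assume "\<sigma> \<in> {\<sigma>. \<sigma> permutes {..<?m}}"
    then have \<sigma>: "\<sigma> permutes {..<?m}" by simp
    have "(\<Prod>i<?m div 2. mat ?m ?m (\<lambda>(i, j). pf_entry (v i) (v j)) $$ (\<sigma> (2 * i), \<sigma> (2 * i + 1))) =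
       (\<Prod>i<k. pf_entry (v (\<sigma> (2 * i))) (v (\<sigma> (2 * i + 1))))"
      using permutes_in_image[OF \<sigma>] by (intro prod.cong) auto
    then show "of_int (sign \<sigma>) *
      (\<Prod>i<?m div 2. mat ?m ?m (\<lambda>(i, j). pf_entry (v i) (v j)) $$ (\<sigma> (2 * i), \<sigma> (2 * i + 1))) =
      D * (of_int (sign \<sigma>) * (\<Prod>i<k. S (\<sigma> (2 * i)) (\<sigma> (2 * i + 1))))"
      using entries[OF \<sigma>] by simp
  qed (simp add: lessThan_atLeast0)
  also have "\<dots> = D * (2 ^ k * fact k * upper_prod ?m S)"
    unfolding sum_distrib_left[symmetric]
  proof (subst pfaffian_sum_eq_upper_prod)
    show "skew_on {..<?m} S"
      unfolding skew_on_def S_def by (intro ballI impI schur_ratio_skew v ne) auto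
    show "S a b \<noteq> 0" if "a < ?m" "b < ?m" "a \<noteq> b" for a b
      unfolding S_def using that by (intro schur_ratio_nonzero v ne)
  qed (use rel in auto)
  finally show ?thesis
    by (simp add: pfaffian_def Let_def D_def S_def[abs_def])
qed

section \<open>Positions of rows and columns and the hook product\<close>

text \<open>Partitions as functions, so that adding a box is a function update. Index 0 is left free
  since parts are numbered from 1.\<close>

definition bounded_partition :: "nat \<Rightarrow> (nat \<Rightarrow> nat) \<Rightarrow> bool" where
  "bounded_partition n p \<longleftrightarrow> (\<forall>i j. 1 \<le> i \<longrightarrow> i \<le> j \<longrightarrow> p j \<le> p i) \<and> (\<forall>i>n. p i = 0)"

definition conj_fun :: "nat \<Rightarrow> (nat \<Rightarrow> nat) \<Rightarrow> nat \<Rightarrow> nat" where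
  "conj_fun n p y = card {x \<in> {1..n}. y \<le> p x}"

definition row_pos :: "nat \<Rightarrow> (nat \<Rightarrow> nat) \<Rightarrow> nat \<Rightarrow> int" where
  "row_pos n p x = int (p x) + int n - int x"

text \<open>The offset makes \<open>row_pos n p x - col_pos n p y\<close> the hook length of the box
  \<open>(x, y)\<close>, and makes sums of two column positions the second kind of El Samra--King
  factor for \<open>N = 2n\<close>.\<close>

definition col_pos :: "nat \<Rightarrow> (nat \<Rightarrow> nat) \<Rightarrow> nat \<Rightarrow> int" where
  "col_pos n p y = int n - 1 + int y - int (conj_fun n p y)"

lemma bounded_partition_antimono: "bounded_partition n p \<Longrightarrow> 1 \<le> i \<Longrightarrow> i \<le> j \<Longrightarrow> p j \<le> p i"
  by (simp add: bounded_partition_def)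

lemma bounded_partition_zero: "bounded_partition n p \<Longrightarrow> n < i \<Longrightarrow> p i = 0"
  by (simp add: bounded_partition_def)

lemma conj_fun_le: "conj_fun n p y \<le> n"
proof -
  have "conj_fun n p y \<le> card {1..n}" unfolding conj_fun_def by (intro card_mono) auto
  then show ?thesis by simp
qed

lemma conj_fun_antimono: "y \<le> z \<Longrightarrow> conj_fun n p z \<le> conj_fun n p y"
  unfolding conj_fun_def by (intro card_mono) auto

text \<open>As \<open>p\<close> is weakly decreasing, the rows reaching column \<open>y\<close> form
  an initial segment.\<close>

lemma le_conj_fun_iff:
  assumes p: "bounded_partition n p" and "1 \<le> x" "1 \<le> y"
  shows "x \<le> conj_fun n p y \<longleftrightarrow> y \<le> p x"
proof
  assume y: "y \<le> p x"
  then have "x \<le> n" using bounded_partition_zero[OF p, of x] assms(3) by (cases "x \<le> n") auto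
  then have "{1..x} \<subseteq> {x \<in> {1..n}. y \<le> p x}"
    by (auto intro!: order_trans[OF y] bounded_partition_antimono[OF p])
  then have "card {1..x} \<le> conj_fun n p y" unfolding conj_fun_def by (intro card_mono) auto
  then show "x \<le> conj_fun n p y" by simp
next
  assume x: "x \<le> conj_fun n p y"
  show "y \<le> p x"
  proof (rule ccontr)
    assume y: "\<not> y \<le> p x"
    have "{x \<in> {1..n}. y \<le> p x} \<subseteq> {1..<x}"
    proof
      fix z assume z: "z \<in> {x \<in> {1..n}. y \<le> p x}"
      then have "\<not> x \<le> z" using y bounded_partition_antimono[OF p assms(2), of z] by auto
      then show "z \<in> {1..<x}" using z by simp
    qed
    then have "conj_fun n p y \<le> card {1..<x}" unfolding conj_fun_def by (intro card_mono) auto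
    then show False using x assms by simp
  qed
qed

lemma row_pos_less: "bounded_partition n p \<Longrightarrow> 1 \<le> i \<Longrightarrow> i < j \<Longrightarrow> row_pos n p j < row_pos n p i"
  using bounded_partition_antimono[of n p i j] by (simp add: row_pos_def)

lemma row_pos_eq_iff:
  "bounded_partition n p \<Longrightarrow> 1 \<le> i \<Longrightarrow> 1 \<le> j \<Longrightarrow> row_pos n p i = row_pos n p j \<longleftrightarrow> i = j"
  by (metis row_pos_less linorder_neq_iff)

lemma col_pos_less: "i < j \<Longrightarrow> col_pos n p i < col_pos n p j"
  using conj_fun_antimono[of i j n p] by (simp add: col_pos_def)

lemma col_pos_eq_iff: "col_pos n p i = col_pos n p j \<longleftrightarrow> i = j"
  by (metis col_pos_less linorder_neq_iff)

lemma row_pos_nonneg: "x \<le> n \<Longrightarrow> 0 \<le> row_pos n p x"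
  by (simp add: row_pos_def)

lemma col_pos_nonneg: "1 \<le> y \<Longrightarrow> 0 \<le> col_pos n p y"
  using conj_fun_le[of n p y] by (simp add: col_pos_def)

text \<open>The difference is a hook length, hence at least 1, for a box of the diagram, and at most
  -1 for a box outside it.\<close>

lemma row_pos_neq_col_pos:
  assumes p: "bounded_partition n p" and xy: "1 \<le> x" "1 \<le> y"
  shows "row_pos n p x \<noteq> col_pos n p y"
  using le_conj_fun_iff[OF p xy] unfolding row_pos_def col_pos_def by linarith

text \<open>The lattice path bounding the diagram: the vertical steps below row \<open>x\<^sub>0\<close> and the horizontal steps
  left of column \<open>y\<^sub>0\<close> have the positions \<open>0, 1, \<dots>\<close> if \<open>(x\<^sub>0, y\<^sub>0)\<close> is a point of the path.\<close>

lemma prod_positions: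
  fixes F :: "int \<Rightarrow> 'a::comm_monoid_mult"
  assumes p: "bounded_partition n p" and x0: "x0 \<le> n" "x0 = 0 \<or> y0 \<le> p x0" and y0: "p (Suc x0) \<le> y0"
  shows "(\<Prod>x\<in>{x0<..n}. F (row_pos n p x)) * (\<Prod>y=1..y0. F (col_pos n p y)) =
    (\<Prod>t<n - x0 + y0. F (int t))"
proof -
  define R where "R = row_pos n p ` {x0<..n}"
  define C where "C = col_pos n p ` {1..y0}"
  have injR: "inj_on (row_pos n p) {x0<..n}"
    by (rule inj_onI) (simp add: row_pos_eq_iff[OF p])
  have injC: "inj_on (col_pos n p) {1..y0}"
    by (rule inj_onI) (simp add: col_pos_eq_iff)
  have disj: "R \<inter> C = {}"
    using row_pos_neq_col_pos[OF p] by (auto simp: R_def C_def)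
  have sub: "R \<union> C \<subseteq> int ` {..<n - x0 + y0}"
  proof
    fix z assume "z \<in> R \<union> C"
    then have "0 \<le> z \<and> z < int (n - x0 + y0)"
    proof
      assume "z \<in> R"
      then obtain x where x: "x0 < x" "x \<le> n" "z = row_pos n p x" by (auto simp: R_def)
      have "p x \<le> p (Suc x0)" using x by (intro bounded_partition_antimono[OF p]) auto
      then show ?thesis using x y0 by (auto simp: row_pos_def)
    next
      assume "z \<in> C"
      then obtain y where y: "1 \<le> y" "y \<le> y0" "z = col_pos n p y" by (auto simp: C_def)
      \<comment> \<open>Every column \<open>y \<le> y0\<close> reaches down to row
        \<open>x0\<close>, which bounds its position from above; \<open>x0 = 0\<close> is the top
        end of the path.\<close>
      have "x0 \<le> conj_fun n p y"
      proof (cases "x0 = 0")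
        case False
        then show ?thesis using x0 y by (subst le_conj_fun_iff[OF p]) auto
      qed simp
      then show ?thesis
        using y x0 col_pos_nonneg[OF y(1), of n p] by (auto simp: col_pos_def)
    qed
    then show "z \<in> int ` {..<n - x0 + y0}"
      by (intro image_eqI[of _ _ "nat z"]) auto
  qed
  \<comment> \<open>Disjointness and injectivity give as many positions as the range has, so
    inclusion becomes equality.\<close>
  have "card (R \<union> C) = n - x0 + y0"
    using disj injR injC by (simp add: card_Un_disjoint R_def C_def card_image)
  moreover have "card (int ` {..<n - x0 + y0}) = n - x0 + y0"
    by (simp add: card_image)
  ultimately have "R \<union> C = int ` {..<n - x0 + y0}"
    using sub by (simp add: card_subset_eq)
  then have "(\<Prod>t<n - x0 + y0. F (int t)) = (\<Prod>z\<in>R \<union> C. F z)"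
    by (simp add: prod.reindex)
  also have "\<dots> = (\<Prod>z\<in>R. F z) * (\<Prod>z\<in>C. F z)"
    using disj by (intro prod.union_disjoint) (auto simp: R_def C_def)
  finally show ?thesis
    using injR injC by (simp add: R_def C_def prod.reindex)
qed

section \<open>The hook product in terms of positions\<close>

definition diagram :: "nat \<Rightarrow> (nat \<Rightarrow> nat) \<Rightarrow> (nat \<times> nat) set" where
  "diagram n p = (SIGMA x:{1..n}. {1..p x})"

definition hook_fun :: "nat \<Rightarrow> (nat \<Rightarrow> nat) \<Rightarrow> real" where
  "hook_fun n p = (\<Prod>(x, y)\<in>diagram n p. of_int (row_pos n p x - col_pos n p y))"

lemma prod_diff_lessThan: "(\<Prod>t<k. real k - real t) = fact k"
proof -
  have "(\<Prod>t<k. real k - real t) = (\<Prod>t<k. real (k - t))"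
    by (intro prod.cong) (auto simp: of_nat_diff)
  also have "\<dots> = real (\<Prod>t<k. k - t)" by simp
  also have "(\<Prod>t<k. k - t) = fact k"
    using fact_prod_rev[of k, where 'a = nat] by (simp add: lessThan_atLeast0)
  finally show ?thesis by simp
qed

text \<open>At the path point \<open>(x, p x)\<close> the positions are those below
  \<open>row_pos n p x\<close>; their differences from it multiply to its factorial.\<close>

lemma hook_fun_eq:
  assumes p: "bounded_partition n p"
  shows "hook_fun n p * (\<Prod>x=1..n. \<Prod>y\<in>{x<..n}. of_int (row_pos n p x - row_pos n p y)) =
    (\<Prod>x=1..n. fact (nat (row_pos n p x)))"
proof -
  have "hook_fun n p = (\<Prod>x=1..n. \<Prod>y=1..p x. of_int (row_pos n p x - col_pos n p y))"
    unfolding hook_fun_def diagram_def by (simp add: prod.Sigma)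
  moreover have "(\<Prod>y=1..p x. of_int (row_pos n p x - col_pos n p y)) *
      (\<Prod>y\<in>{x<..n}. of_int (row_pos n p x - row_pos n p y)) = (fact (nat (row_pos n p x)) :: real)"
    if x: "x \<in> {1..n}" for x
  proof -
    let ?k = "n - x + p x"
    have k: "row_pos n p x = int ?k" using x by (simp add: row_pos_def of_nat_diff)
    have "(\<Prod>y\<in>{x<..n}. real_of_int (row_pos n p x - row_pos n p y)) *
        (\<Prod>y=1..p x. real_of_int (row_pos n p x - col_pos n p y)) =
        (\<Prod>t<?k. real_of_int (row_pos n p x - int t))"
      using x by (intro prod_positions[OF p]) (auto intro: bounded_partition_antimono[OF p])
    also have "\<dots> = fact ?k"
      unfolding k using prod_diff_lessThan[of ?k] by simp
    also have "?k = nat (row_pos n p x)" by (simp only: k nat_int)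
    finally show ?thesis by (simp add: mult.commute)
  qed
  ultimately show ?thesis by (simp add: prod.distrib[symmetric])
qed

section \<open>The El Samra--King product\<close>

text \<open>The numerator of the El Samra--King formula for \<open>N = 2n\<close>, without the hook
  product.\<close>

definition orth_fun :: "nat \<Rightarrow> (nat \<Rightarrow> nat) \<Rightarrow> real" where
  "orth_fun n p = (\<Prod>(x, y)\<in>diagram n p.
     if x \<le> y then of_int (row_pos n p x + row_pos n p y) else of_int (col_pos n p x + col_pos n p y))"

text \<open>Dividing by the hook product cancels the factorials and leaves Weyl's product of
  differences of squared positions. The factor 2 is absent at position 0, which only an empty row
  \<open>n\<close> can have.\<close>

definition weyl_num :: "nat \<Rightarrow> (nat \<Rightarrow> nat) \<Rightarrow> real" where
  "weyl_num n p = (\<Prod>x=1..n. (if row_pos n p x > 0 then 2 else 1) * fact (nat (row_pos n p x))) *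
     (\<Prod>x=1..n. \<Prod>y\<in>{x<..n}. of_int (row_pos n p x + row_pos n p y))"

section \<open>Products along a row, a column or a run of positions\<close>

lemma prod_row:
  assumes "finite D"
  shows "(\<Prod>(x, y)\<in>D. if x = a \<and> Q y then h y else 1) = (\<Prod>y | (a, y) \<in> D \<and> Q y. h y)"
proof -
  have "(\<Prod>(x, y)\<in>D. if x = a \<and> Q y then h y else 1) =
      (\<Prod>(x, y)\<in>Pair a ` {y. (a, y) \<in> D \<and> Q y}. h y)"
    using assms by (intro prod.mono_neutral_cong_right) auto
  then show ?thesis by (simp add: prod.reindex inj_on_def)
qed

lemma prod_col:
  assumes "finite D"
  shows "(\<Prod>(x, y)\<in>D. if y = a \<and> Q x then h x else 1) = (\<Prod>x | (x, a) \<in> D \<and> Q x. h x)"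
proof -
  have "(\<Prod>(x, y)\<in>D. if y = a \<and> Q x then h x else 1) =
      (\<Prod>(x, y)\<in>(\<lambda>x. (x, a)) ` {x. (x, a) \<in> D \<and> Q x}. h x)"
    using assms by (intro prod.mono_neutral_cong_right) auto
  then show ?thesis by (simp add: prod.reindex inj_on_def)
qed

lemma finite_diagram: "finite (diagram n p)"
  by (simp add: diagram_def)

lemma mem_diagram_iff: "(x, y) \<in> diagram n p \<longleftrightarrow> 1 \<le> x \<and> x \<le> n \<and> 1 \<le> y \<and> y \<le> p x"
  by (auto simp: diagram_def)

lemma prod_shift_ratio_lessThan:
  fixes u :: real
  assumes "u > 0"
  shows "(\<Prod>t<k. (u + 1 + real t) / (u + real t)) = (u + real k) / u"
proof (induction k)
  case (Suc k)
  have "u + real k > 0" using assms by simp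
  then have "(u + real k) / u * ((u + 1 + real k) / (u + real k)) = (u + real (Suc k)) / u"
    by (simp add: add_ac)
  then show ?case using Suc by simp
qed (use assms in simp)

text \<open>The factor 2 for \<open>u = 0\<close> is the one by which dimensions double when the last part becomes positive.\<close>

lemma prod_shift_ratio_skip:
  assumes "u + 2 \<le> k"
  shows "(if u = 0 then 2 else 1) * (real u + 1) *
    (\<Prod>t<k. if t = u \<or> t = u + 1 then 1 else (real u + 1 + real t) / (real u + real t)) = real u + real k"
  using assms
proof (induction k rule: dec_induct)
  \<comment> \<open>For \<open>u > 0\<close> the product telescopes to 2; for \<open>u = 0\<close>
    it is empty and the leading factor supplies the 2.\<close>
  case base
  have "(\<Prod>t<u + 2. if t = u \<or> t = u + 1 then 1 else (real u + 1 + real t) / (real u + real t)) =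
      (\<Prod>t<u. (real u + 1 + real t) / (real u + real t))"
    by (simp add: numeral_2_eq_2)
  then show ?case
    using prod_shift_ratio_lessThan[of "real u" u] by (cases "u = 0") (auto simp: field_simps)
next
  case (step k)
  let ?w = "(real u + 1 + real k) / (real u + real k)"
  let ?P = "\<Prod>t<k. if t = u \<or> t = u + 1 then 1 else (real u + 1 + real t) / (real u + real t)"
  have "(\<Prod>t<Suc k. if t = u \<or> t = u + 1 then 1 else (real u + 1 + real t) / (real u + real t)) = ?w * ?P"
    using step.hyps by simp
  then have "(if u = 0 then 2 else 1) * (real u + 1) *
      (\<Prod>t<Suc k. if t = u \<or> t = u + 1 then 1 else (real u + 1 + real t) / (real u + real t)) =
      ?w * ((if u = 0 then 2 else 1) * (real u + 1) * ?P)"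
    by (simp only: mult_ac)
  also have "\<dots> = ?w * (real u + real k)" by (simp only: step.IH)
  also have "\<dots> = real u + real (Suc k)" using step.hyps by simp
  finally show ?case .
qed

lemma prod_shift_ratio_down:
  assumes "r \<le> b" "b < u + n"
  shows "(\<Prod>y\<in>{r<..b}. (real u + 1 + (real n - real y)) / (real u + (real n - real y))) =
    (real u + real n - real r) / (real u + real n - real b)"
  using assms
proof (induction b rule: dec_induct)
  case base
  then show ?case by simp
next
  case (step b)
  have "{r<..Suc b} = insert (Suc b) {r<..b}" using step.hyps by auto
  moreover have "real u + real n - real b > 0" "real u + real n - real (Suc b) > 0"
    using step.prems by linarith+
  ultimately show ?case using step by (simp add: field_simps)
qed

text \<open>A box is added at the end \<open>(r, c)\<close> of the last nonempty row (or of the empty row below it). It moves row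
  \<open>r\<close> from position \<open>u\<close> to \<open>u + 1\<close> and column \<open>c\<close> from \<open>u + 1\<close> to \<open>u\<close>, so a factor \<open>u + t\<close> of
  \<open>weyl_num\<close> or \<open>orth_fun\<close> changes by \<open>\<rho> t\<close> or its inverse.\<close>

locale add_box =
  fixes n r :: nat and p :: "nat \<Rightarrow> nat"
  assumes p: "bounded_partition n p" and r: "1 \<le> r" "r \<le> n"
    and above: "\<And>x. 1 \<le> x \<Longrightarrow> x < r \<Longrightarrow> p r < p x" and below: "\<And>x. r < x \<Longrightarrow> p x = 0"
begin

definition c where "c = Suc (p r)"
definition p' where "p' = p(r := c)"
definition u where "u = p r + n - r"

abbreviation "L \<equiv> row_pos n p"
abbreviation "C \<equiv> col_pos n p"

definition \<rho> :: "int \<Rightarrow> real" where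
  "\<rho> t = (real u + 1 + of_int t) / (real u + of_int t)"

lemma c_pos: "1 \<le> c" by (simp add: c_def)

lemma L_r: "L r = int u" using r by (simp add: row_pos_def u_def of_nat_diff)

lemma L'_eq: "row_pos n p' x = (if x = r then L r + 1 else L x)"
  by (simp add: row_pos_def p'_def c_def)

lemma conj_c: "conj_fun n p c = r - 1"
proof -
  have "{x \<in> {1..n}. c \<le> p x} = {1..<r}"
  proof (intro equalityI subsetI)
    fix x assume x: "x \<in> {x \<in> {1..n}. c \<le> p x}"
    then have "\<not> r \<le> x" using bounded_partition_antimono[OF p r(1), of x] by (auto simp: c_def)
    then show "x \<in> {1..<r}" using x by simp
  qed (use above r in \<open>auto simp: c_def Suc_le_eq\<close>)
  then show ?thesis by (simp add: conj_fun_def)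
qed

lemma C_c: "C c = int u + 1"
  using r by (simp add: col_pos_def conj_c of_nat_diff) (simp add: u_def c_def of_nat_diff)

lemma C'_eq: "col_pos n p' y = (if y = c then int u else C y)"
proof -
  have "{x \<in> {1..n}. y \<le> p' x} = (if y = c then insert r {x \<in> {1..n}. y \<le> p x} else {x \<in> {1..n}. y \<le> p x})"
    using r by (auto simp: p'_def c_def)
  moreover have "r \<notin> {x \<in> {1..n}. c \<le> p x}" by (simp add: c_def)
  ultimately have "conj_fun n p' y = (if y = c then Suc (conj_fun n p y) else conj_fun n p y)"
    by (auto simp: conj_fun_def)
  then show ?thesis using C_c by (auto simp: col_pos_def)
qed

lemma diagram': "diagram n p' = insert (r, c) (diagram n p)" and new: "(r, c) \<notin> diagram n p"
  using r by (auto simp: diagram_def p'_def c_def split: if_splits)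

lemma L_neq: "1 \<le> x \<Longrightarrow> x \<noteq> r \<Longrightarrow> L x \<noteq> L r"
  using row_pos_eq_iff[OF p _ r(1)] by simp

lemma u_plus_L_pos: "1 \<le> x \<Longrightarrow> x \<le> n \<Longrightarrow> x \<noteq> r \<Longrightarrow> 0 < int u + L x"
  using L_neq[of x] row_pos_nonneg[of x n p] unfolding L_r by linarith

text \<open>Only row \<open>r\<close> moves: its factorial gains \<open>u + 1\<close>, a factor 2
  appears when it leaves position 0, and each sum with another row \<open>x\<close> gains
  \<open>\<rho> (L x)\<close>.\<close>

lemma weyl_num_step:
  "weyl_num n p' = (if u = 0 then 2 else 1) * (real u + 1) * (\<Prod>x\<in>{1..n}-{r}. \<rho> (L x)) * weyl_num n p"
proof -
  let ?s = "\<lambda>p x. (if row_pos n p x > 0 then 2 else 1) * fact (nat (row_pos n p x)) :: real"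
  have r_in: "r \<in> {1..n}" using r by simp
  have "(\<Prod>x=1..n. ?s p' x) = ?s p' r * (\<Prod>x\<in>{1..n}-{r}. ?s p x)"
    by (subst prod.remove[OF _ r_in]) (auto intro!: prod.cong simp: L'_eq)
  also have "?s p' r = (if u = 0 then 2 else 1) * (real u + 1) * ?s p r"
    by (simp add: L'_eq L_r nat_add_distrib)
  finally have 1: "(\<Prod>x=1..n. ?s p' x) = (if u = 0 then 2 else 1) * (real u + 1) * (\<Prod>x=1..n. ?s p x)"
    by (subst (2) prod.remove[OF _ r_in]) simp_all
  define g where "g x y = (if x = r then \<rho> (L y) else if y = r then \<rho> (L x) else 1)" for x y
  have "(\<Prod>x=1..n. \<Prod>y\<in>{x<..n}. real_of_int (row_pos n p' x + row_pos n p' y)) =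
      (\<Prod>x=1..n. \<Prod>y\<in>{x<..n}. g x y * of_int (L x + L y))"
  proof (intro prod.cong refl)
    fix x y assume xy: "x \<in> {1..n}" "y \<in> {x<..n}"
    then have "x = r \<Longrightarrow> real_of_int (int u + L y) \<noteq> 0" "y = r \<Longrightarrow> real_of_int (int u + L x) \<noteq> 0"
      using u_plus_L_pos[of x] u_plus_L_pos[of y] by (auto simp del: of_int_add)
    then show "real_of_int (row_pos n p' x + row_pos n p' y) = g x y * of_int (L x + L y)"
      using xy by (auto simp: L'_eq L_r g_def \<rho>_def add_ac)
  qed
  also have "\<dots> = (\<Prod>x=1..n. \<Prod>y\<in>{x<..n}. g x y) * (\<Prod>x=1..n. \<Prod>y\<in>{x<..n}. of_int (L x + L y))"
    by (simp only: prod.distrib)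
  also have "(\<Prod>x=1..n. \<Prod>y\<in>{x<..n}. g x y) = (\<Prod>x\<in>{1..n}-{r}. \<rho> (L x))"
  proof -
    have "(\<Prod>x=1..n. \<Prod>y\<in>{x<..n}. g x y) =
        (\<Prod>y\<in>{r<..n}. g r y) * (\<Prod>x\<in>{1..n}-{r}. \<Prod>y\<in>{x<..n}. g x y)"
      by (subst prod.remove[OF _ r_in]) auto
    also have "(\<Prod>x\<in>{1..n}-{r}. \<Prod>y\<in>{x<..n}. g x y) =
        (\<Prod>x\<in>{1..n}-{r}. if x < r then \<rho> (L x) else 1)"
    proof (rule prod.cong[OF refl])
      fix x assume x: "x \<in> {1..n} - {r}"
      then have "(\<Prod>y\<in>{x<..n}. g x y) = (\<Prod>y\<in>{x<..n}. if y = r then \<rho> (L x) else 1)"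
        by (intro prod.cong) (auto simp: g_def)
      also have "\<dots> = (if x < r then \<rho> (L x) else 1)" using r by (simp add: prod.delta)
      finally show "(\<Prod>y\<in>{x<..n}. g x y) = (if x < r then \<rho> (L x) else 1)" .
    qed
    also have "\<dots> = (\<Prod>x\<in>{1..<r}. \<rho> (L x))"
      using r by (intro prod.mono_neutral_cong_right) auto
    also have "(\<Prod>y\<in>{r<..n}. g r y) = (\<Prod>y\<in>{r<..n}. \<rho> (L y))"
      by (simp add: g_def)
    also have "(\<Prod>y\<in>{r<..n}. \<rho> (L y)) * (\<Prod>x\<in>{1..<r}. \<rho> (L x)) = (\<Prod>x\<in>{r<..n} \<union> {1..<r}. \<rho> (L x))"
      by (rule prod.union_disjoint[symmetric]) auto
    also have "{r<..n} \<union> {1..<r} = {1..n} - {r}" using r by auto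
    finally show ?thesis .
  qed
  finally show ?thesis unfolding weyl_num_def 1 by simp
qed

text \<open>The factors are, in order: the new box; then, as row \<open>r\<close> moves, column
  \<open>r\<close> above the diagonal, row \<open>r\<close> right of it and the box
  \<open>(r, r)\<close>; then, as column \<open>c\<close> moves, row \<open>c\<close> left of the
  diagonal and column \<open>c\<close> below it. The last five are collected by \<open>gA\<close> to
  \<open>gE\<close>.\<close>

lemma orth_fun_step_aux:
  "orth_fun n p' =
     (if r = c then 2 * (real u + 1) else if r \<le> c then real u + 1 + of_int (L c) else of_int (C r) + real u) *
     (\<Prod>x | 1 \<le> x \<and> x < r \<and> r \<le> p x. \<rho> (L x)) * (\<Prod>y\<in>{r<..p r}. \<rho> (L y)) *
     (if r \<le> p r then (real u + 1) / real u else 1) *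
     (\<Prod>y | c \<le> n \<and> 1 \<le> y \<and> y < c \<and> y \<le> p c. 1 / \<rho> (C y)) * (\<Prod>x\<in>{c<..<r}. 1 / \<rho> (C x)) *
     orth_fun n p"
proof -
  define f where "f p x y = (if x \<le> y then real_of_int (row_pos n p x + row_pos n p y)
    else of_int (col_pos n p x + col_pos n p y))" for p and x y :: nat
  define gA where "gA x y = (if y = r \<and> x < r then \<rho> (L x) else 1)" for x y
  define gB where "gB x y = (if x = r \<and> r < y then \<rho> (L y) else 1)" for x y
  define gC where "gC x y = (if x = r \<and> y = r then (real u + 1) / real u else 1)" for x y
  define gD where "gD x y = (if x = c \<and> y < c then 1 / \<rho> (C y) else 1)" for x y
  define gE where "gE x y = (if y = c \<and> c < x then 1 / \<rho> (C x) else 1)" for x y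
  note fin = finite_diagram[of n p]
  have step: "f p' x y = gA x y * gB x y * gC x y * gD x y * gE x y * f p x y"
    if xy: "(x, y) \<in> diagram n p" for x y
  proof -
    from xy have xy': "1 \<le> x" "x \<le> n" "1 \<le> y" "y \<le> p x" by (auto simp: mem_diagram_iff)
    have "real_of_int (L x + L y) > 0" using xy' by (simp only: of_int_0_less_iff) (simp add: row_pos_def)
    moreover have "real_of_int (C x + C y) > 0" if "x > y"
    proof -
      have "C y < C x" using that by (rule col_pos_less)
      then show ?thesis using col_pos_nonneg[OF xy'(3), of n p] by (simp only: of_int_0_less_iff)
    qed
    moreover have "real u + 1 + of_int (C y) > 0" "real u + 1 + of_int (C x) > 0"
      using col_pos_nonneg[OF xy'(3), of n p] col_pos_nonneg[OF xy'(1), of n p]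
      by (simp_all add: add_pos_nonneg)
    moreover have "r = c \<longrightarrow> C r = int u + 1" by (metis C_c)
    ultimately show ?thesis
      unfolding f_def gA_def gB_def gC_def gD_def gE_def L'_eq C'_eq
      by (auto simp: L_r C_c \<rho>_def add_ac)
  qed
  have "orth_fun n p' = (\<Prod>(x, y)\<in>diagram n p'. f p' x y)" by (simp add: orth_fun_def f_def)
  also have "\<dots> = f p' r c * (\<Prod>(x, y)\<in>diagram n p. f p' x y)"
    unfolding diagram' using new fin by simp
  also have "(\<Prod>(x, y)\<in>diagram n p. f p' x y) =
      (\<Prod>(x, y)\<in>diagram n p. gA x y * gB x y * gC x y * gD x y * gE x y * f p x y)"
    by (intro prod.cong) (auto simp: step)
  also have "\<dots> = (\<Prod>(x, y)\<in>diagram n p. gA x y) * (\<Prod>(x, y)\<in>diagram n p. gB x y) *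
      (\<Prod>(x, y)\<in>diagram n p. gC x y) * (\<Prod>(x, y)\<in>diagram n p. gD x y) *
      (\<Prod>(x, y)\<in>diagram n p. gE x y) * (\<Prod>(x, y)\<in>diagram n p. f p x y)"
    by (simp add: case_prod_unfold prod.distrib)
  also have "(\<Prod>(x, y)\<in>diagram n p. gA x y) = (\<Prod>x | 1 \<le> x \<and> x < r \<and> r \<le> p x. \<rho> (L x))"
    unfolding gA_def prod_col[OF fin] by (rule prod.cong) (use r in \<open>auto simp: mem_diagram_iff\<close>)
  also have "(\<Prod>(x, y)\<in>diagram n p. gB x y) = (\<Prod>y\<in>{r<..p r}. \<rho> (L y))"
    unfolding gB_def prod_row[OF fin] by (rule prod.cong) (use r in \<open>auto simp: mem_diagram_iff\<close>)
  also have "(\<Prod>(x, y)\<in>diagram n p. gC x y) = (if r \<le> p r then (real u + 1) / real u else 1)"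
  proof -
    have "{y. (r, y) \<in> diagram n p \<and> y = r} = (if r \<le> p r then {r} else {})"
      using r by (auto simp: mem_diagram_iff)
    then show ?thesis unfolding gC_def prod_row[OF fin] by simp
  qed
  also have "(\<Prod>(x, y)\<in>diagram n p. gD x y) =
      (\<Prod>y | c \<le> n \<and> 1 \<le> y \<and> y < c \<and> y \<le> p c. 1 / \<rho> (C y))"
    unfolding gD_def prod_row[OF fin]
    by (rule prod.cong) (use c_pos in \<open>auto simp: mem_diagram_iff\<close>)
  also have "(\<Prod>(x, y)\<in>diagram n p. gE x y) = (\<Prod>x\<in>{c<..<r}. 1 / \<rho> (C x))"
    unfolding gE_def prod_col[OF fin]
  proof (rule prod.cong)
    have "c \<le> p x \<longleftrightarrow> x < r" if "1 \<le> x" for x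
      using le_conj_fun_iff[OF p that c_pos] conj_c r by auto
    then show "{x. (x, c) \<in> diagram n p \<and> c < x} = {c<..<r}"
      using r c_pos by (auto simp: mem_diagram_iff)
  qed simp
  also have "f p' r c = (if r = c then 2 * (real u + 1) else if r \<le> c then real u + 1 + of_int (L c)
      else of_int (C r) + real u)"
    by (simp add: f_def L'_eq C'_eq L_r)
  also have "(\<Prod>(x, y)\<in>diagram n p. f p x y) = orth_fun n p" by (simp add: orth_fun_def f_def)
  finally show ?thesis by (simp only: mult.assoc)
qed

text \<open>If \<open>r < c\<close>, the rows below \<open>r\<close> are empty and everything
  telescopes. If \<open>c \<le> r\<close>, \<open>prod_positions\<close> trades the inverse column
  factors for the missing row factors.\<close>

lemma orth_fun_step:
  "orth_fun n p' = (if u = 0 then 2 else 1) * (real u + 1) * (\<Prod>x\<in>{1..n}-{r}. \<rho> (L x)) * orth_fun n p"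
proof (cases "r < c")
  case True
  then have rp: "r \<le> p r" by (simp add: c_def)
  have u: "u > 0" using rp r by (simp add: u_def)
  \<comment> \<open>This includes \<open>x > n\<close>, where the position is negative; such indices
    occur because columns may outnumber \<open>n\<close>.\<close>
  have L_below: "L x = int n - int x" if "r < x" for x
    using below[OF that] by (simp add: row_pos_def)
  have above': "{x. 1 \<le> x \<and> x < r \<and> r \<le> p x} = {1..<r}"
    using above rp by force
  have prod_below: "(\<Prod>y\<in>{r<..b}. \<rho> (L y)) = (real u + real n - real r) / (real u + real n - real b)"
    if "r \<le> b" "b < u + n" for b
    using prod_shift_ratio_down[OF that] by (simp add: \<rho>_def L_below)
  have 1: "(\<Prod>y\<in>{r<..p r}. \<rho> (L y)) * (real u + 1 + of_int (L c)) = real u + real n - real r"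
  proof -
    have lt: "p r < u + n" using r by (simp add: u_def)
    then have "real u + real n - real (p r) > 0" by linarith
    then show ?thesis
      unfolding prod_below[OF rp lt] L_below[OF True] by (simp add: c_def add_diff_eq)
  qed
  have 2: "(\<Prod>y\<in>{r<..n}. \<rho> (L y)) * real u = real u + real n - real r"
    using prod_below[of n] r u by simp
  have split: "{1..n} - {r} = {1..<r} \<union> {r<..n}" using r by auto
  have 3: "(\<Prod>x\<in>{1..n}-{r}. \<rho> (L x)) = (\<Prod>x\<in>{1..<r}. \<rho> (L x)) * (\<Prod>x\<in>{r<..n}. \<rho> (L x))"
    unfolding split by (rule prod.union_disjoint) auto
  have "p c = 0" using below[OF True] .
  then have 4: "{y. c \<le> n \<and> 1 \<le> y \<and> y < c \<and> y \<le> p c} = {}" by auto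
  define A where "A = (\<Prod>x\<in>{1..<r}. \<rho> (L x))"
  define B where "B = (\<Prod>y\<in>{r<..p r}. \<rho> (L y))"
  define B' where "B' = (\<Prod>y\<in>{r<..n}. \<rho> (L y))"
  have "orth_fun n p' = (real u + 1 + of_int (L c)) * A * B * ((real u + 1) / real u) * orth_fun n p"
    unfolding orth_fun_step_aux above' 4 A_def B_def using True rp by simp
  also have "\<dots> = (B * (real u + 1 + of_int (L c))) * A * (real u + 1) / real u * orth_fun n p"
    by simp
  also have "B * (real u + 1 + of_int (L c)) = B' * real u" unfolding B_def B'_def 1 2 ..
  also have "B' * real u * A * (real u + 1) / real u = (real u + 1) * (A * B')" using u by simp
  finally show ?thesis unfolding 3 using u by (simp add: A_def B'_def)
next
  case False
  then have cr: "c \<le> r" by simp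
  \<comment> \<open>\<open>(q, r - 1)\<close> is the point where the bounding path meets column
    \<open>r\<close>, so the rows below \<open>q\<close> and the columns left of \<open>r\<close>
    fill the positions below \<open>k = C r\<close>.\<close>
  define q where "q = conj_fun n p r"
  define k where "k = n - q + (r - 1)"
  have q_iff: "x \<le> q \<longleftrightarrow> r \<le> p x" if "1 \<le> x" for x
    unfolding q_def by (rule le_conj_fun_iff[OF p that r(1)])
  have q_less: "q < r" using q_iff[OF r(1)] cr by (simp add: c_def)
  have q_le: "q \<le> n" using q_less r by simp
  have k: "int k = C r" using q_le r by (simp add: k_def col_pos_def q_def of_nat_diff)
  have \<rho>_nz: "\<rho> (C y) \<noteq> 0" if "1 \<le> y" for y
  proof -
    have "0 < int u + C y"
      using row_pos_neq_col_pos[OF p r(1) that] col_pos_nonneg[OF that, of n p] unfolding L_r by linarith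
    then have "0 < real u + of_int (C y)" by linarith
    then show ?thesis by (simp add: \<rho>_def)
  qed
  \<comment> \<open>Masks the positions of row \<open>r\<close> and column \<open>c\<close>, whose
    own factors are not among the ratios.\<close>
  define F where "F t = (if t = int u \<or> t = int u + 1 then 1 else \<rho> t)" for t
  have FL: "F (L x) = (if x = r then 1 else \<rho> (L x))" if "1 \<le> x" for x
    using row_pos_eq_iff[OF p that r(1)] row_pos_neq_col_pos[OF p that c_pos]
    by (auto simp: F_def L_r C_c)
  have FC: "F (C y) = (if y = c then 1 else \<rho> (C y))" if "1 \<le> y" for y
    using col_pos_eq_iff[of n p y c] row_pos_neq_col_pos[OF p r(1) that]
    by (auto simp: F_def L_r C_c)
  have set_id: "(\<Prod>x\<in>{q<..n}. F (L x)) * (\<Prod>y=1..r-1. F (C y)) = (\<Prod>t<k. F (int t))"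
    unfolding k_def
  proof (rule prod_positions[OF p q_le])
    show "q = 0 \<or> r - 1 \<le> p q" using q_iff[of q] by (cases "q = 0") auto
    show "p (Suc q) \<le> r - 1" using q_iff[of "Suc q"] by auto
  qed
  define X where "X = (\<Prod>x\<in>{q<..n}-{r}. \<rho> (L x))"
  define Y where "Y = (\<Prod>y\<in>{1..<r}-{c}. \<rho> (C y))"
  define A where "A = (\<Prod>x=1..q. \<rho> (L x))"
  have X: "(\<Prod>x\<in>{q<..n}. F (L x)) = X"
    unfolding X_def using q_less r FL by (intro prod.mono_neutral_cong_right) auto
  have Y: "(\<Prod>y=1..r-1. F (C y)) = Y"
    unfolding Y_def using FC c_pos by (intro prod.mono_neutral_cong_right) auto
  have split: "{1..n} - {r} = {1..q} \<union> ({q<..n} - {r})" using q_less r by auto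
  have AX: "(\<Prod>x\<in>{1..n}-{r}. \<rho> (L x)) = A * X"
    unfolding A_def X_def split by (rule prod.union_disjoint) auto
  have Y0: "Y \<noteq> 0" unfolding Y_def using \<rho>_nz by simp
  define N where "N = (if r = c then 2 * (real u + 1) else of_int (C r) + real u)"
  have N: "N = (if u = 0 then 2 else 1) * (real u + 1) * (X * Y)"
  proof (cases "c = r")
    case True
    \<comment> \<open>For a diagonal box, \<open>k = u + 1\<close>: only the last position in range
      is masked, and the full run below \<open>u\<close> telescopes.\<close>
    have "u = n - 1" using True r by (simp add: u_def c_def)
    moreover have "q = r - 1" using conj_c True by (simp add: q_def)
    ultimately have k': "k = Suc u" using r by (simp add: k_def)
    have "X * Y = (\<Prod>t<k. F (int t))" using set_id X Y by simp
    also have "\<dots> = (\<Prod>t<u. (real u + 1 + real t) / (real u + real t))"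
      by (simp add: k' F_def \<rho>_def)
    finally show ?thesis
      using True prod_shift_ratio_lessThan[of "real u" u] by (cases "u = 0") (auto simp: N_def)
  next
    case False
    \<comment> \<open>Column \<open>r\<close> lies right of column \<open>c\<close>, so both masked
      positions are below \<open>k\<close>.\<close>
    then have "int u + 1 < C r" using col_pos_less[of c r n p] cr C_c by simp
    then have "u + 2 \<le> k" using k by linarith
    moreover have "X * Y = (\<Prod>t<k. if t = u \<or> t = u + 1 then 1 else (real u + 1 + real t) / (real u + real t))"
    proof -
      have "F (int t) = (if t = u \<or> t = u + 1 then 1 else (real u + 1 + real t) / (real u + real t))" for t
        by (auto simp: F_def \<rho>_def)
      then show ?thesis using set_id X Y by simp
    qed
    ultimately show ?thesis
      using prod_shift_ratio_skip[of u k] False k by (simp add: N_def add.commute)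
  qed
  have 1: "{x. 1 \<le> x \<and> x < r \<and> r \<le> p x} = {1..q}"
    using q_iff q_less by auto
  have 2: "{y. c \<le> n \<and> 1 \<le> y \<and> y < c \<and> y \<le> p c} = {1..<c}"
  proof -
    \<comment> \<open>Row \<open>c\<close> is either row \<open>r\<close> itself, of length
      \<open>c - 1\<close>, or a longer row above it.\<close>
    have "y \<le> p c" if "y < c" for y
      using that above[of c] c_pos cr by (cases "c = r") (auto simp: c_def)
    then show ?thesis using cr r by auto
  qed
  have split': "{1..<r} - {c} = {1..<c} \<union> {c<..<r}" using cr c_pos by auto
  have 3: "(\<Prod>y\<in>{1..<c}. 1 / \<rho> (C y)) * (\<Prod>y\<in>{c<..<r}. 1 / \<rho> (C y)) = 1 / Y"
    unfolding Y_def split' by (subst prod.union_disjoint) (auto simp: prod_dividef)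
  have pr: "p r < r" using cr by (simp add: c_def)
  then have row_empty: "{r<..p r} = {}" by simp
  have new_factor: "(if r = c then 2 * (real u + 1) else if r \<le> c then real u + 1 + of_int (L c)
      else of_int (C r) + real u) = N"
    using cr by (simp add: N_def)
  have "orth_fun n p' = N * A * ((\<Prod>y\<in>{1..<c}. 1 / \<rho> (C y)) * (\<Prod>y\<in>{c<..<r}. 1 / \<rho> (C y))) * orth_fun n p"
    unfolding orth_fun_step_aux 1 2 A_def row_empty new_factor using pr by simp
  also have "\<dots> = (if u = 0 then 2 else 1) * (real u + 1) * (A * X) * orth_fun n p"
    unfolding 3 N using Y0 by simp
  finally show ?thesis unfolding AX .
qed

end

section \<open>The empty partition and induction over boxes\<close>

lemma weyl_num_zero:
  assumes "n \<ge> 1"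
  shows "weyl_num n (\<lambda>_. 0) = (\<Prod>k=1..n-1. fact (2 * k))"
proof -
  define w where "w n = (\<Prod>x=1..n. (if x < n then 2 else 1) * fact (n - x)) *
    (\<Prod>x=1..n. \<Prod>y\<in>{x<..n}. real (n - x) + real (n - y))" for n
  have "weyl_num n (\<lambda>_. 0) = w n" for n
    unfolding weyl_num_def w_def row_pos_def
    by (intro arg_cong2[of _ _ _ _ "(*)"] prod.cong refl) (auto simp: nat_diff_distrib of_nat_diff)
  moreover have "w (Suc n) = (\<Prod>k=1..n. fact (2 * k))" for n
  proof (induction n)
    case 0
    then show ?case by (simp add: w_def)
  next
    case (Suc n)
    have im: "{Suc x<..Suc m} = Suc ` {x<..m}" for x m
      by (auto simp: image_iff Suc_less_eq2 Suc_le_eq)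
    \<comment> \<open>The positions of the empty partition run down to 0, so one more row amounts to
      a new top row at position \<open>n + 1\<close>. Its doubled factorial and its sums with
      \<open>0, ..., n\<close> combine to \<open>fact (2 * Suc n)\<close>.\<close>
    have "w (Suc (Suc n)) = 2 * fact (Suc n) * (\<Prod>y\<in>{1<..Suc (Suc n)}. real (Suc n) + real (Suc (Suc n) - y)) * w (Suc n)"
      unfolding w_def by (simp add: prod.atLeast_Suc_atMost_Suc_shift prod.atLeast_Suc_atMost im prod.reindex del: prod.cl_ivl_Suc)
    also have "2 * fact (Suc n) * (\<Prod>y\<in>{1<..Suc (Suc n)}. real (Suc n) + real (Suc (Suc n) - y)) = fact (2 * Suc n)"
    proof -
      have rising: "fact n * (\<Prod>j<k. real (Suc n) + real j) = fact (n + k)" for k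
      proof (induction k)
        case (Suc k)
        have "fact n * (\<Prod>j<Suc k. real (Suc n) + real j) =
            (fact n * (\<Prod>j<k. real (Suc n) + real j)) * (real (Suc n) + real k)" by simp
        also have "\<dots> = fact (n + k) * (real (Suc n) + real k)" by (simp only: Suc.IH)
        finally show ?case by (simp add: algebra_simps)
      qed simp
      have "(\<Prod>y\<in>{1<..Suc (Suc n)}. real (Suc n) + real (Suc (Suc n) - y)) = (\<Prod>j<Suc n. real (Suc n) + real j)"
        by (rule prod.reindex_bij_witness[of _ "\<lambda>j. Suc (Suc n) - j" "\<lambda>y. Suc (Suc n) - y"]) auto
      then have "2 * fact (Suc n) * (\<Prod>y\<in>{1<..Suc (Suc n)}. real (Suc n) + real (Suc (Suc n) - y)) =
          2 * real (Suc n) * (fact n * (\<Prod>j<Suc n. real (Suc n) + real j))"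
        by (simp add: mult.assoc del: prod.lessThan_Suc)
      also have "\<dots> = 2 * real (Suc n) * fact (n + Suc n)" by (simp only: rising)
      also have "\<dots> = fact (Suc (n + Suc n))" by simp
      also have "Suc (n + Suc n) = 2 * Suc n" by simp
      finally show ?thesis .
    qed
    finally show ?case using Suc by simp
  qed
  ultimately show ?thesis using assms by (cases n) auto
qed

text \<open>Both sides agree for the empty partition and gain the same factor with each added
  box.\<close>

lemma orth_fun_eq:
  assumes "n \<ge> 1" and "bounded_partition n p"
  shows "orth_fun n p * (\<Prod>k=1..n-1. fact (2 * k)) = weyl_num n p"
  using assms(2)
proof (induction "\<Sum>x=1..n. p x" arbitrary: p rule: less_induct)
  case less
  show ?case
  proof (cases "\<forall>x\<in>{1..n}. p x = 0")
    case True
    then have "row_pos n p x = row_pos n (\<lambda>_. 0) x" if "x \<in> {1..n}" for x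
      using that by (simp add: row_pos_def)
    then have "weyl_num n p = weyl_num n (\<lambda>_. 0)"
      unfolding weyl_num_def by (intro arg_cong2[of _ _ _ _ "(*)"] prod.cong refl) auto
    moreover have "diagram n p = {}" using True by (auto simp: diagram_def)
    ultimately show ?thesis using weyl_num_zero[OF assms(1)] by (simp add: orth_fun_def)
  next
    case False
    \<comment> \<open>Removing a box from the last nonempty row leaves a partition, since everything
      below is empty.\<close>
    define r where "r = Max {x\<in>{1..n}. p x > 0}"
    have "r \<in> {x\<in>{1..n}. p x > 0}" unfolding r_def using False by (intro Max_in) auto
    then have r_box: "1 \<le> r" "r \<le> n" "p r > 0" by auto
    have below: "p x = 0" if "r < x" for x
    proof (rule ccontr)
      assume "p x \<noteq> 0"
      then have "x \<in> {x\<in>{1..n}. p x > 0}"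
        using bounded_partition_zero[OF less.prems, of x] that by (cases "x \<le> n") auto
      then have "x \<le> r" unfolding r_def by (intro Max_ge) auto
      then show False using that by simp
    qed
    define p0 where "p0 = p(r := p r - 1)"
    have p0: "bounded_partition n p0"
      unfolding bounded_partition_def
    proof (intro conjI allI impI)
      fix i j :: nat assume ij: "1 \<le> i" "i \<le> j"
      have "p j \<le> p i" using bounded_partition_antimono[OF less.prems ij] .
      then show "p0 j \<le> p0 i" using below[of j] ij by (auto simp: p0_def)
    next
      fix i assume "n < i"
      then show "p0 i = 0" using bounded_partition_zero[OF less.prems] r_box by (auto simp: p0_def)
    qed
    interpret add_box n r p0
    proof
      show "p0 r < p0 x" if "1 \<le> x" "x < r" for x
        using bounded_partition_antimono[OF less.prems, of x r] that r_box by (auto simp: p0_def)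
    qed (use p0 r_box below in \<open>auto simp: p0_def\<close>)
    have "Suc (p0 r) = p r" using r_box by (simp add: p0_def)
    then have p'_eq: "p' = p" by (simp add: p'_def c_def) (simp add: p0_def)
    have "(\<Sum>x=1..n. p0 x) < (\<Sum>x=1..n. p x)"
      using r_box by (intro sum_strict_mono_ex1) (auto simp: p0_def intro!: bexI[of _ r])
    then have "orth_fun n p0 * (\<Prod>k=1..n-1. fact (2 * k)) = weyl_num n p0"
      by (rule less.hyps[OF _ p0])
    then show ?thesis
      using orth_fun_step weyl_num_step unfolding p'_eq by (simp add: mult.assoc)
  qed
qed

section \<open>Partitions as lists\<close>

lemma bounded_partition_part:
  assumes "is_partition lam" "length lam \<le> n"
  shows "bounded_partition n (part lam)"
  unfolding bounded_partition_def
proof (intro conjI allI impI)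
  fix i j :: nat assume ij: "1 \<le> i" "i \<le> j"
  have "lam ! (j - 1) \<le> lam ! (i - 1)" if "i < j" "j \<le> length lam"
    using assms(1) that ij by (auto simp: is_partition_def sorted_wrt_iff_nth_less)
  then show "part lam j \<le> part lam i"
    using ij by (cases "i = j") (auto simp: part_def)
qed (use assms(2) in \<open>simp add: part_def\<close>)

lemma boxes_eq_diagram:
  assumes "length lam \<le> n"
  shows "boxes lam = diagram n (part lam)"
  using assms by (auto simp: boxes_def diagram_def part_def split: if_splits)

lemma conj_part_eq_conj_fun:
  assumes "length lam \<le> n" "1 \<le> y"
  shows "conj_part lam y = conj_fun n (part lam) y"
  unfolding conj_part_def conj_fun_def
  using assms by (intro arg_cong[of _ _ card]) (auto simp: part_def split: if_splits)

lemma hook_prod_eq_hook_fun: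
  assumes "length lam \<le> n"
  shows "hook_prod lam = hook_fun n (part lam)"
  unfolding hook_prod_def hook_fun_def boxes_eq_diagram[OF assms]
  by (intro prod.cong refl)
    (auto simp: row_pos_def col_pos_def mem_diagram_iff conj_part_eq_conj_fun[OF assms])

lemma orth_dim_eq_orth_fun:
  assumes "length lam \<le> n"
  shows "orth_dim lam (2 * n) = orth_fun n (part lam) / hook_prod lam"
proof -
  let ?D = "diagram n (part lam)"
  let ?f = "\<lambda>x y. real_of_int (row_pos n (part lam) x + row_pos n (part lam) y)"
  let ?g = "\<lambda>x y. real_of_int (col_pos n (part lam) x + col_pos n (part lam) y)"
  have 1: "(\<Prod>(x, y)\<in>{(x, y) \<in> boxes lam. x \<le> y}.
      real (2 * n) + real (part lam x) + real (part lam y) - real x - real y) =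
      (\<Prod>(x, y)\<in>{(x, y) \<in> ?D. x \<le> y}. ?f x y)"
    unfolding boxes_eq_diagram[OF assms] by (intro prod.cong refl) (auto simp: row_pos_def)
  have 2: "(\<Prod>(x, y)\<in>{(x, y) \<in> boxes lam. x > y}.
      real (2 * n) - real (conj_part lam x) - real (conj_part lam y) + real x + real y - 2) =
      (\<Prod>(x, y)\<in>{(x, y) \<in> ?D. x > y}. ?g x y)"
    unfolding boxes_eq_diagram[OF assms]
    by (intro prod.cong refl)
      (auto simp: col_pos_def mem_diagram_iff conj_part_eq_conj_fun[OF assms])
  have "orth_fun n (part lam) =
      (\<Prod>z\<in>?D. if fst z \<le> snd z then ?f (fst z) (snd z) else ?g (fst z) (snd z))"
    by (simp add: orth_fun_def case_prod_unfold)
  also have "\<dots> = (\<Prod>z\<in>?D \<inter> {z. fst z \<le> snd z}. ?f (fst z) (snd z)) *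
      (\<Prod>z\<in>?D \<inter> - {z. fst z \<le> snd z}. ?g (fst z) (snd z))"
    by (rule prod.If_cases[OF finite_diagram])
  also have "?D \<inter> {z. fst z \<le> snd z} = {(x, y) \<in> ?D. x \<le> y}" by auto
  also have "?D \<inter> - {z. fst z \<le> snd z} = {(x, y) \<in> ?D. x > y}" by auto
  finally show ?thesis
    unfolding orth_dim_def 1 2 by (simp add: case_prod_unfold)
qed

section \<open>The Pfaffian of the given matrix\<close>

lemma upper_prod_shift:
  "upper_prod n (\<lambda>i j. A (Suc i) (Suc j)) = (\<Prod>x=1..n. \<Prod>y\<in>{x<..n}. A x y)"
proof -
  have "{Suc i<..n} = Suc ` {i<..<n}" for i
    by (auto simp: image_Suc_atLeastLessThan simp flip: atLeastSucLessThan_greaterThanLessThan)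
  then show ?thesis
    by (simp add: upper_prod_def prod.atLeast1_atMost_eq prod.reindex)
qed

lemma upper_prod_Suc: "upper_prod (Suc n) A = upper_prod n A * (\<Prod>i<n. A i n)"
proof -
  have "{i<..<Suc n} = insert n {i<..<n}" if "i < n" for i using that by auto
  then have "(\<Prod>i<n. \<Prod>j\<in>{i<..<Suc n}. A i j) = (\<Prod>i<n. A i n * (\<Prod>j\<in>{i<..<n}. A i j))"
    by (intro prod.cong) auto
  moreover have "{n<..<Suc n} = {}" by auto
  ultimately show ?thesis by (simp add: upper_prod_def prod.distrib mult.commute)
qed

text \<open>For odd \<open>n\<close> the extra index is the empty row \<open>n + 1\<close> at
  position -1; its scale and its ratios with all earlier rows are 1, so it leaves the product
  unchanged.\<close>

lemma pfaffian_pf_mat: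
  assumes lam: "is_partition lam" "length lam \<le> n"
  shows "pfaffian (pf_mat lam n (if even n then n else n + 1)) =
    (\<Prod>x=1..n. entry_scale (row_pos n (part lam) x)) *
    (\<Prod>x=1..n. \<Prod>y\<in>{x<..n}. schur_ratio (row_pos n (part lam) x) (row_pos n (part lam) y))"
proof -
  note p = bounded_partition_part[OF lam]
  define v where "v i = row_pos n (part lam) (Suc i)" for i
  define m where "m = (if even n then n else n + 1)"
  have "even m" by (simp add: m_def)
  then obtain k where k: "m = 2 * k" by blast
  have "pf_mat lam n m = mat m m (\<lambda>(i, j). pf_entry (v i) (v j))"
    by (simp add: pf_mat_def v_def row_pos_def)
  moreover have "inj_on v {..<2 * k}"
    by (rule inj_onI) (simp add: v_def row_pos_eq_iff[OF p])
  moreover have "v i \<ge> -1" if "i < 2 * k" for i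
    using that by (auto simp: v_def row_pos_def m_def simp flip: k split: if_splits)
  ultimately have "pfaffian (pf_mat lam n m) =
      (\<Prod>i<m. entry_scale (v i)) * upper_prod m (\<lambda>i j. schur_ratio (v i) (v j))"
    using pfaffian_pf_entry[of v k] k by simp
  also have "\<dots> = (\<Prod>i<n. entry_scale (v i)) * upper_prod n (\<lambda>i j. schur_ratio (v i) (v j))"
  proof (cases "even n")
    case False
    have vn: "v n = -1" using bounded_partition_zero[OF p, of "Suc n"] by (simp add: v_def row_pos_def)
    have "0 \<le> v i" if "i < n" for i
      using row_pos_nonneg[of "Suc i" n "part lam"] that by (simp add: v_def)
    then have "schur_ratio (v i) (v n) = 1" if "i < n" for i
      using that by (force simp: vn schur_ratio_def)
    then show ?thesis using False by (simp add: m_def upper_prod_Suc vn entry_scale_def)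
  qed (simp add: m_def)
  finally show ?thesis
    unfolding m_def v_def using upper_prod_shift[of n "\<lambda>x y. schur_ratio (row_pos n (part lam) x) (row_pos n (part lam) y)"]
    by (simp add: prod.atLeast1_atMost_eq)
qed

theorem theorem5p4:
  fixes n :: nat and lam :: "nat list"
  assumes "n \<ge> 1" and "is_partition lam" and "length lam \<le> n"
  shows "a_coeff lam n = 1 / ((hook_prod lam)\<^sup>2 * orth_dim lam (2 * n)) \<and>
    1 / ((hook_prod lam)\<^sup>2 * orth_dim lam (2 * n)) =
      (if even n then (\<Prod>k = 1..n - 1. fact (2 * k)) * pfaffian (pf_mat lam n n)
       else (\<Prod>k = 1..n - 1. fact (2 * k)) * pfaffian (pf_mat lam n (n + 1)))"
proof
  show "a_coeff lam n = 1 / ((hook_prod lam)\<^sup>2 * orth_dim lam (2 * n))" by (rule a_coeff_def)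
  note p = bounded_partition_part[OF assms(2,3)]
  define L where "L = row_pos n (part lam)"
  define T :: real where "T = (\<Prod>x=1..n. if L x > 0 then 2 else 1)"
  define fct :: real where "fct = (\<Prod>x=1..n. fact (nat (L x)))"
  define dif :: real where "dif = (\<Prod>x=1..n. \<Prod>y\<in>{x<..n}. of_int (L x - L y))"
  define sm :: real where "sm = (\<Prod>x=1..n. \<Prod>y\<in>{x<..n}. of_int (L x + L y))"
  define K :: real where "K = (\<Prod>k=1..n-1. fact (2 * k))"
  define H where "H = hook_prod lam"
  define R where "R = orth_fun n (part lam)"
  have pos: "L y \<ge> 0" "L x > L y" if "x \<in> {1..n}" "y \<in> {x<..n}" for x y
    using that row_pos_less[OF p, of x y] row_pos_nonneg[of y n "part lam"] by (auto simp: L_def)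
  have "T \<noteq> 0" "fct \<noteq> 0" "K \<noteq> 0" by (simp_all add: T_def fct_def K_def)
  have "of_int (L x + L y) \<noteq> (0::real)" if "x \<in> {1..n}" "y \<in> {x<..n}" for x y
    using pos[OF that] by (simp only: of_int_eq_0_iff)
  then have "sm \<noteq> 0" unfolding sm_def by (simp del: of_int_add)
  have hook: "H * dif = fct"
    using hook_fun_eq[OF p] unfolding H_def hook_prod_eq_hook_fun[OF assms(3)] dif_def fct_def L_def .
  have orth: "R * K = T * fct * sm"
    using orth_fun_eq[OF assms(1) p]
    unfolding R_def K_def weyl_num_def T_def fct_def sm_def L_def by (simp only: prod.distrib)
  have scale: "(\<Prod>x=1..n. entry_scale (L x)) = 1 / (T * fct\<^sup>2)"
  proof -
    have "entry_scale (L x) = 1 / ((if L x > 0 then 2 else 1) * (fact (nat (L x)))\<^sup>2)" if "x \<in> {1..n}" for x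
      using row_pos_nonneg[of x n "part lam"] that by (auto simp: entry_scale_def L_def)
    then show ?thesis
      by (simp add: T_def fct_def prod_dividef prod.distrib prod_power_distrib)
  qed
  have ratio: "(\<Prod>x=1..n. \<Prod>y\<in>{x<..n}. schur_ratio (L x) (L y)) = dif / sm"
  proof -
    have "schur_ratio (L x) (L y) = of_int (L x - L y) / of_int (L x + L y)"
      if "x \<in> {1..n}" "y \<in> {x<..n}" for x y
      using pos[OF that] by (simp add: schur_ratio_def)
    then show ?thesis by (simp add: dif_def sm_def prod_dividef)
  qed
  have pf: "pfaffian (pf_mat lam n (if even n then n else n + 1)) = dif / (T * fct\<^sup>2 * sm)"
    using pfaffian_pf_mat[OF assms(2,3)] unfolding L_def[symmetric] scale ratio by simp
  have "H \<noteq> 0" using hook \<open>fct \<noteq> 0\<close> by auto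
  have "1 / (H\<^sup>2 * orth_dim lam (2 * n)) = 1 / (H * R)"
    unfolding orth_dim_eq_orth_fun[OF assms(3)] H_def[symmetric] R_def[symmetric]
    using \<open>H \<noteq> 0\<close> by (simp add: power2_eq_square)
  \<comment> \<open>Expanding by \<open>dif * K\<close> makes \<open>hook\<close> and
    \<open>orth\<close> applicable; \<open>dif\<close> is nonzero because
    \<open>H * dif = fct\<close>.\<close>
  also have "\<dots> = (dif * K) / ((H * dif) * (R * K))"
    using hook \<open>fct \<noteq> 0\<close> \<open>K \<noteq> 0\<close> by auto
  also have "\<dots> = K * (dif / (T * fct\<^sup>2 * sm))"
    unfolding hook orth by (simp add: power2_eq_square mult_ac)
  also have "dif / (T * fct\<^sup>2 * sm) = pfaffian (pf_mat lam n (if even n then n else n + 1))"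
    by (rule pf[symmetric])
  finally show "1 / ((hook_prod lam)\<^sup>2 * orth_dim lam (2 * n)) =
      (if even n then (\<Prod>k = 1..n - 1. fact (2 * k)) * pfaffian (pf_mat lam n n)
       else (\<Prod>k = 1..n - 1. fact (2 * k)) * pfaffian (pf_mat lam n (n + 1)))"
    unfolding H_def K_def by simp
qed

end
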